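(* Let $G$ be a countably infinite group. Then the $C^*$-algebra $\ell^\infty(G,\mathcal{K})$ admits no non-zero lower semi-continuous $G$-invariant densely defined trace, and, consequently, the Roe algebra $\ell^\infty(G,\mathcal{K}) \rtimes G$ admits no non-zero densely defined lower semi-continuous trace.
   Context: $\mathcal{K}$ is the $C^*$-algebra of compact operators on a separable infinite dimensional Hilbert space, and $\ell^\infty(G,\mathcal{K})$ is the $C^*$-algebra of bounded functions $G \to \mathcal{K}$, with $G$ acting by left-translation, $(t.f)(s) = f(t^{-1}s)$; $\ell^\infty(G,\mathcal{K}) \rtimes G$ is the reduced crossed product. The Pedersen ideal $\mathrm{Ped}(\mathcal{A})$ of a $C^*$-algebra $\mathcal{A}$ is its smallest dense (algebraic) two-sided ideal. The densely defined lower semi-continuous traces on $\mathcal{A}$ are identified with the positive linear maps $\tau \colon \mathrm{Ped}(\mathcal{A}) \to \mathbb{C}$ satisfying $\tau(x^*x)=\tau(xx^* )$ whenever $x \in \mathcal{A}$ and $x^*x \in \mathrm{Ped}(\mathcal{A})$ (such maps are automatically lower semi-continuous). *)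

theory Defs
  imports "HOL-Analysis.Analysis"
begin

section \<open>Normed *-algebras with explicit carrier, Pedersen ideal, traces\<close>

text \<open>
  C*-algebras are represented by records, so that an algebra may be a proper subset of its ambient
  type. The notions below use just the record operations; they are applied to C*-algebras only.
\<close>

record 'e cstar =
  carrier :: "'e set"
  add :: "'e \<Rightarrow> 'e \<Rightarrow> 'e"
  scale :: "complex \<Rightarrow> 'e \<Rightarrow> 'e"
  mult :: "'e \<Rightarrow> 'e \<Rightarrow> 'e"
  star :: "'e \<Rightarrow> 'e"
  cnorm :: "'e \<Rightarrow> real"

definition two_sided_ideal :: "('e, 'm) cstar_scheme \<Rightarrow> 'e set \<Rightarrow> bool" where
  "two_sided_ideal A I \<longleftrightarrow>
     I \<subseteq> carrier A \<and> I \<noteq> {} \<and>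
     (\<forall>x\<in>I. \<forall>y\<in>I. add A x y \<in> I) \<and>
     (\<forall>c. \<forall>x\<in>I. scale A c x \<in> I) \<and>
     (\<forall>a\<in>carrier A. \<forall>x\<in>I. mult A a x \<in> I \<and> mult A x a \<in> I)"

definition dense_in :: "('e, 'm) cstar_scheme \<Rightarrow> 'e set \<Rightarrow> bool" where
  "dense_in A I \<longleftrightarrow>
     (\<forall>a\<in>carrier A. \<forall>\<epsilon>>0. \<exists>x\<in>I. cnorm A (add A a (scale A (-1) x)) < \<epsilon>)"

text \<open>\<open>LEAST\<close> refers to inclusion; for a C*-algebra the least dense ideal exists by Pedersen's theorem.\<close>

definition Ped :: "('e, 'm) cstar_scheme \<Rightarrow> 'e set" where
  "Ped A = (LEAST I. two_sided_ideal A I \<and> dense_in A I)"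

definition positive_elements :: "('e, 'm) cstar_scheme \<Rightarrow> 'e set" where
  "positive_elements A = {mult A (star A y) y | y. y \<in> carrier A}"

text \<open>
  Densely defined lower semi-continuous traces, identified with the positive linear maps
  \<open>\<tau> : Ped A \<rightarrow> \<complex>\<close> with \<open>\<tau> (x* x) = \<tau> (x x*)\<close> whenever \<open>x* x \<in> Ped A\<close> (lower semi-continuity is then
  automatic). The values of \<open>\<tau>\<close> outside \<open>Ped A\<close> are irrelevant.
\<close>

definition densely_defined_lsc_trace :: "('e, 'm) cstar_scheme \<Rightarrow> ('e \<Rightarrow> complex) \<Rightarrow> bool" where
  "densely_defined_lsc_trace A \<tau> \<longleftrightarrow>
     (\<forall>x\<in>Ped A. \<forall>y\<in>Ped A. \<tau> (add A x y) = \<tau> x + \<tau> y) \<and>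
     (\<forall>c. \<forall>x\<in>Ped A. \<tau> (scale A c x) = c * \<tau> x) \<and>
     (\<forall>x \<in> Ped A \<inter> positive_elements A. \<tau> x \<in> \<real>\<^sub>\<ge>\<^sub>0) \<and>
     (\<forall>x\<in>carrier A. mult A (star A x) x \<in> Ped A \<longrightarrow>
        \<tau> (mult A (star A x) x) = \<tau> (mult A x (star A x)))"

definition nonzero_trace :: "('e, 'm) cstar_scheme \<Rightarrow> ('e \<Rightarrow> complex) \<Rightarrow> bool" where
  "nonzero_trace A \<tau> \<longleftrightarrow> (\<exists>x\<in>Ped A. \<tau> x \<noteq> 0)"

definition invariant_trace ::
  "('e, 'm) cstar_scheme \<Rightarrow> ('g \<Rightarrow> 'e \<Rightarrow> 'e) \<Rightarrow> ('e \<Rightarrow> complex) \<Rightarrow> bool" where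
  "invariant_trace A \<alpha> \<tau> \<longleftrightarrow> (\<forall>t. \<forall>x\<in>Ped A. \<tau> (\<alpha> t x) = \<tau> x)"


section \<open>The Hilbert space of square-summable families\<close>

typedef 'a ell2 = "{f :: 'a \<Rightarrow> complex. (\<lambda>i. (cmod (f i))\<^sup>2) summable_on UNIV}"
  morphisms coord Abs_ell2
  by (rule exI[of _ "\<lambda>_. 0"]) simp

setup_lifting type_definition_ell2

lemma coord_summable: "(\<lambda>i. (cmod (coord x i))\<^sup>2) summable_on UNIV"
  using coord[of x] by simp

lemma ell2_eqI: "(\<And>i. coord x i = coord y i) \<Longrightarrow> x = y"
  by (metis coord_inject ext)

lemma cmod_add_sq_le: "(cmod (a + b))\<^sup>2 \<le> 2 * (cmod a)\<^sup>2 + 2 * (cmod b)\<^sup>2"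
proof -
  have "(cmod (a + b))\<^sup>2 \<le> (cmod a + cmod b)\<^sup>2"
    by (intro power_mono norm_triangle_ineq) auto
  also have "\<dots> \<le> 2 * (cmod a)\<^sup>2 + 2 * (cmod b)\<^sup>2"
    using sum_squares_bound[of "cmod a" "cmod b"] by (simp add: power2_sum)
  finally show ?thesis .
qed

lemma square_summable_add:
  assumes "(\<lambda>i. (cmod (f i))\<^sup>2) summable_on S" "(\<lambda>i. (cmod (g i))\<^sup>2) summable_on S"
  shows "(\<lambda>i. (cmod (f i + g i))\<^sup>2) summable_on S"
proof (rule summable_on_comparison_test)
  show "(\<lambda>i. 2 * (cmod (f i))\<^sup>2 + 2 * (cmod (g i))\<^sup>2) summable_on S"
    by (intro summable_on_add summable_on_cmult_right assms)
qed (auto intro: cmod_add_sq_le)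

lemma square_summable_scale:
  assumes "(\<lambda>i. (cmod (f i))\<^sup>2) summable_on S"
  shows "(\<lambda>i. (cmod (c * f i))\<^sup>2) summable_on S"
  using summable_on_cmult_right[OF assms, of "(cmod c)\<^sup>2"]
  by (simp add: norm_mult power_mult_distrib)

lift_definition scaleC :: "complex \<Rightarrow> 'a ell2 \<Rightarrow> 'a ell2" is "\<lambda>c f i. c * f i"
  by (rule square_summable_scale)

definition cinner :: "'a ell2 \<Rightarrow> 'a ell2 \<Rightarrow> complex" where
  "cinner x y = (\<Sum>\<^sub>\<infinity>i. coord x i * cnj (coord y i))"

lemma cinner_summable: "(\<lambda>i. coord x i * cnj (coord y i)) summable_on UNIV"
proof (rule abs_summable_summable, rule summable_on_comparison_test)
  show "(\<lambda>i. (cmod (coord x i))\<^sup>2 + (cmod (coord y i))\<^sup>2) summable_on UNIV"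
    by (intro summable_on_add coord_summable)
  show "norm (coord x i * cnj (coord y i)) \<le> (cmod (coord x i))\<^sup>2 + (cmod (coord y i))\<^sup>2" for i
    using sum_squares_bound[of "cmod (coord x i)" "cmod (coord y i)"]
      mult_nonneg_nonneg[OF norm_ge_zero[of "coord x i"] norm_ge_zero[of "coord y i"]]
    unfolding norm_mult complex_mod_cnj by linarith
qed simp

instantiation ell2 :: (type) real_inner
begin

lift_definition zero_ell2 :: "'a ell2" is "\<lambda>_. 0" by simp
lift_definition plus_ell2 :: "'a ell2 \<Rightarrow> 'a ell2 \<Rightarrow> 'a ell2" is "\<lambda>f g i. f i + g i"
  by (rule square_summable_add)
lift_definition uminus_ell2 :: "'a ell2 \<Rightarrow> 'a ell2" is "\<lambda>f i. - f i" by simp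
lift_definition minus_ell2 :: "'a ell2 \<Rightarrow> 'a ell2 \<Rightarrow> 'a ell2" is "\<lambda>f g i. f i - g i"
  using square_summable_add[where g = "\<lambda>i. - _ i"] by fastforce
lift_definition scaleR_ell2 :: "real \<Rightarrow> 'a ell2 \<Rightarrow> 'a ell2" is "\<lambda>r f i. complex_of_real r * f i"
  by (rule square_summable_scale)

definition inner_ell2 :: "'a ell2 \<Rightarrow> 'a ell2 \<Rightarrow> real" where
  "inner_ell2 x y = Re (cinner x y)"
definition norm_ell2 :: "'a ell2 \<Rightarrow> real" where
  "norm_ell2 x = sqrt (inner x x)"
definition dist_ell2 :: "'a ell2 \<Rightarrow> 'a ell2 \<Rightarrow> real" where
  "dist_ell2 x y = norm (x - y)"
definition sgn_ell2 :: "'a ell2 \<Rightarrow> 'a ell2" where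
  "sgn_ell2 x = inverse (norm x) *\<^sub>R x"
definition uniformity_ell2 :: "('a ell2 \<times> 'a ell2) filter" where
  "uniformity_ell2 = (INF e\<in>{0<..}. principal {(x, y). dist x y < e})"
definition open_ell2 :: "'a ell2 set \<Rightarrow> bool" where
  "open_ell2 U = (\<forall>x\<in>U. eventually (\<lambda>(x', y). x' = x \<longrightarrow> y \<in> U) uniformity)"

lemma inner_ell2_sum: "inner x y = (\<Sum>\<^sub>\<infinity>i. Re (coord x i * cnj (coord y i)))"
  unfolding inner_ell2_def cinner_def by (rule infsum_Re[symmetric, OF cinner_summable])

lemma inner_ell2_summable: "(\<lambda>i. Re (coord x i * cnj (coord y i))) summable_on UNIV"
  by (rule summable_on_Re[OF cinner_summable])

instance
proof
  fix x y z :: "'a ell2" and a b r :: real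
  show "x + y + z = x + (y + z)" "x + y = y + x" "0 + x = x" "- x + x = 0" "x - y = x + - y"
    "a *\<^sub>R (x + y) = a *\<^sub>R x + a *\<^sub>R y" "(a + b) *\<^sub>R x = a *\<^sub>R x + b *\<^sub>R x"
    "a *\<^sub>R b *\<^sub>R x = (a * b) *\<^sub>R x" "1 *\<^sub>R x = x"
    by (transfer; simp add: algebra_simps fun_eq_iff)+
  show "sgn x = inverse (norm x) *\<^sub>R x" "dist x y = norm (x - y)" "norm x = sqrt (inner x x)"
    by (simp_all add: sgn_ell2_def dist_ell2_def norm_ell2_def)
  show "uniformity = (INF e\<in>{0<..}. principal {(x, y::'a ell2). dist x y < e})"
    by (rule uniformity_ell2_def)
  show "open U = (\<forall>x\<in>U. eventually (\<lambda>(x', y). x' = x \<longrightarrow> y \<in> U) uniformity)" for U :: "'a ell2 set"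
    by (rule open_ell2_def)
  show "inner x y = inner y x"
    unfolding inner_ell2_sum by (intro infsum_cong) (simp add: algebra_simps)
  have "(\<lambda>i. Re (coord (x + y) i * cnj (coord z i))) =
      (\<lambda>i. Re (coord x i * cnj (coord z i)) + Re (coord y i * cnj (coord z i)))"
    by (simp add: plus_ell2.rep_eq algebra_simps)
  then show "inner (x + y) z = inner x z + inner y z"
    unfolding inner_ell2_sum
    by (simp only: infsum_add[OF inner_ell2_summable inner_ell2_summable])
  have "(\<lambda>i. Re (coord (r *\<^sub>R x) i * cnj (coord y i))) = (\<lambda>i. r * Re (coord x i * cnj (coord y i)))"
    by (simp add: scaleR_ell2.rep_eq algebra_simps)
  then show "inner (r *\<^sub>R x) y = r * inner x y"
    unfolding inner_ell2_sum by (simp only: infsum_cmult_right')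
  have nonneg: "0 \<le> Re (coord x i * cnj (coord x i))" for i
    by simp
  then show "0 \<le> inner x x"
    unfolding inner_ell2_sum by (rule infsum_nonneg)
  show "inner x x = 0 \<longleftrightarrow> x = 0"
  proof
    assume "inner x x = 0"
    then have "Re (coord x i * cnj (coord x i)) = 0" for i
      using nonneg_infsum_le_0D[OF _ inner_ell2_summable nonneg] unfolding inner_ell2_sum by auto
    then have "coord x i = 0" for i
      by (simp add: complex_eq_iff sum_squares_eq_zero_iff)
    then show "x = 0"
      by (intro ell2_eqI) (simp add: zero_ell2.rep_eq)
  qed (simp add: inner_ell2_sum zero_ell2.rep_eq)
qed

end

lemma norm_ell2_sq: "(norm x)\<^sup>2 = (\<Sum>\<^sub>\<infinity>i. (cmod (coord x i))\<^sup>2)"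
proof -
  have "(norm x)\<^sup>2 = inner x x"
    by (rule dot_square_norm[symmetric])
  also have "\<dots> = (\<Sum>\<^sub>\<infinity>i. (cmod (coord x i))\<^sup>2)"
    unfolding inner_ell2_sum by (intro infsum_cong) (simp only: cmod_power2, simp add: power2_eq_square)
  finally show ?thesis .
qed


section \<open>Bounded and compact operators\<close>

text \<open>
  The type of bounded real-linear maps with the operator norm; the bounded operators in the usual
  sense are those that are complex linear.
\<close>

type_synonym 'a op = "'a ell2 \<Rightarrow>\<^sub>L 'a ell2"

definition bounded_ops :: "'a op set" where
  "bounded_ops = {T. \<forall>c x. blinfun_apply T (scaleC c x) = scaleC c (blinfun_apply T x)}"

definition compact_ops :: "'a op set" where
  "compact_ops = {T \<in> bounded_ops. compact (closure (blinfun_apply T ` cball 0 1))}"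

definition op_scale :: "complex \<Rightarrow> 'a op \<Rightarrow> 'a op" where
  "op_scale c T = Blinfun (\<lambda>x. scaleC c (blinfun_apply T x))"

definition adjoint_op :: "'a op \<Rightarrow> 'a op" where
  "adjoint_op T = (THE S. S \<in> bounded_ops \<and>
     (\<forall>x y. cinner (blinfun_apply T x) y = cinner x (blinfun_apply S y)))"

definition op_algebra :: "'a op cstar" where
  "op_algebra = \<lparr>carrier = bounded_ops, add = (+), scale = op_scale, mult = (o\<^sub>L),
     star = adjoint_op, cnorm = norm\<rparr>"

lemma norm_scaleC: "norm (scaleC c x) = cmod c * norm x"
proof -
  have "(norm (scaleC c x))\<^sup>2 = (cmod c * norm x)\<^sup>2"
    unfolding norm_ell2_sq power_mult_distrib
    by (simp add: scaleC.rep_eq norm_mult power_mult_distrib infsum_cmult_right')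
  then show ?thesis
    by (simp add: power2_eq_iff_nonneg)
qed

lemma bounded_linear_scaleC: "bounded_linear (scaleC c)"
proof (rule bounded_linear_intro[where K = "cmod c"])
  show "scaleC c (x + y) = scaleC c x + scaleC c y" for x y :: "'a ell2"
    by transfer (simp add: algebra_simps)
  show "scaleC c (r *\<^sub>R x) = r *\<^sub>R scaleC c x" for r and x :: "'a ell2"
    by transfer (simp add: algebra_simps)
qed (simp add: norm_scaleC mult.commute)

lemma op_scale_apply: "blinfun_apply (op_scale c T) x = scaleC c (blinfun_apply T x)"
  unfolding op_scale_def
  by (subst bounded_linear_Blinfun_apply)
    (auto intro: bounded_linear_compose[OF bounded_linear_scaleC] blinfun.bounded_linear_right)


section \<open>Block diagonal operators and translations on \<open>\<ell>\<^sup>2(G \<times> X) = \<ell>\<^sup>2(G, \<ell>\<^sup>2(X))\<close>\<close>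

lift_definition fiber :: "('g \<times> 'x) ell2 \<Rightarrow> 'g \<Rightarrow> 'x ell2" is "\<lambda>f t x. f (t, x)"
proof -
  fix f :: "'g \<times> 'x \<Rightarrow> complex" and t
  assume "(\<lambda>p. (cmod (f p))\<^sup>2) summable_on UNIV"
  then have "(\<lambda>p. (cmod (f p))\<^sup>2) summable_on Pair t ` UNIV"
    by (rule summable_on_subset) simp
  then show "(\<lambda>x. (cmod (f (t, x)))\<^sup>2) summable_on UNIV"
    by (subst (asm) summable_on_reindex) (auto simp: inj_on_def o_def)
qed

text \<open>\<open>(block_diag T \<xi>)(t) = T t (\<xi>(t))\<close> for a uniformly bounded family \<open>T\<close>.\<close>

definition block_diag :: "('g \<Rightarrow> 'x op) \<Rightarrow> ('g \<times> 'x) op" where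
  "block_diag T = Blinfun (\<lambda>\<xi>. Abs_ell2 (\<lambda>(t, x). coord (blinfun_apply (T t) (fiber \<xi> t)) x))"

text \<open>\<open>(translation s \<xi>)(t) = \<xi>(s\<inverse>t)\<close>; see the remark on additive notation below.\<close>

definition translation :: "'g::group_add \<Rightarrow> ('g \<times> 'x) op" where
  "translation s = Blinfun (\<lambda>\<xi>. Abs_ell2 (\<lambda>(t, x). coord \<xi> (- s + t, x)))"

lemma fiber_has_sum:
  "((\<lambda>t. (norm (fiber \<xi> t))\<^sup>2) has_sum (norm \<xi>)\<^sup>2) UNIV"
proof -
  have s: "(\<lambda>p. (cmod (coord \<xi> p))\<^sup>2) summable_on (UNIV \<times> UNIV)"
    using coord_summable[of \<xi>] by simp
  have n: "(norm (fiber \<xi> t))\<^sup>2 = (\<Sum>\<^sub>\<infinity>x. (cmod (coord \<xi> (t, x)))\<^sup>2)" for t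
    by (simp add: norm_ell2_sq fiber.rep_eq)
  have 1: "(\<lambda>t. (norm (fiber \<xi> t))\<^sup>2) summable_on UNIV"
    unfolding n
    by (rule summable_on_SigmaD[OF s]) (use coord_summable[of "fiber \<xi> _"] in \<open>simp add: fiber.rep_eq\<close>)
  have 2: "(\<Sum>\<^sub>\<infinity>t. (norm (fiber \<xi> t))\<^sup>2) = (norm \<xi>)\<^sup>2"
    unfolding n norm_ell2_sq[of \<xi>] using infsum_Sigma_banach[OF s] by simp
  show ?thesis
    using 1 2 has_sum_infsum by metis
qed

lemma block_diag_aux:
  assumes "\<And>t. norm (T t) \<le> B"
  shows "(\<lambda>p. (cmod ((\<lambda>(t, x). coord (blinfun_apply (T t) (fiber \<xi> t)) x) p))\<^sup>2) summable_on UNIV"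
    (is "?f summable_on _")
    and "(\<Sum>\<^sub>\<infinity>p. (cmod ((\<lambda>(t, x). coord (blinfun_apply (T t) (fiber \<xi> t)) x) p))\<^sup>2) \<le> (B * norm \<xi>)\<^sup>2"
proof -
  let ?g = "\<lambda>t. (norm (blinfun_apply (T t) (fiber \<xi> t)))\<^sup>2"
  have le: "?g t \<le> B\<^sup>2 * (norm (fiber \<xi> t))\<^sup>2" for t
  proof -
    have "norm (blinfun_apply (T t) (fiber \<xi> t)) \<le> B * norm (fiber \<xi> t)"
      by (meson assms mult_right_mono norm_blinfun norm_ge_zero order_trans)
    then show ?thesis
      using power_mono[of _ "B * norm (fiber \<xi> t)" 2] by (simp add: power_mult_distrib)
  qed
  have fs: "(\<lambda>t. B\<^sup>2 * (norm (fiber \<xi> t))\<^sup>2) summable_on UNIV"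
    by (intro summable_on_cmult_right) (use fiber_has_sum summable_on_def in blast)
  have g: "?g summable_on UNIV"
    by (rule summable_on_comparison_test[OF fs]) (use le in auto)
  have hs: "((\<lambda>x. ?f (t, x)) has_sum ?g t) UNIV" for t
    using has_sum_infsum[OF coord_summable[of "blinfun_apply (T t) (fiber \<xi> t)"]]
    by (simp add: norm_ell2_sq)
  have "?f summable_on Sigma UNIV (\<lambda>_. UNIV)"
    by (rule summable_on_SigmaI[OF hs g]) auto
  then show s: "?f summable_on UNIV"
    by simp
  have "infsum ?f UNIV = (\<Sum>\<^sub>\<infinity>t. \<Sum>\<^sub>\<infinity>x. ?f (t, x))"
    using infsum_Sigma_banach[of ?f UNIV "\<lambda>_. UNIV"] s by simp
  also have "\<dots> = infsum ?g UNIV"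
    by (intro infsum_cong infsumI hs)
  also have "\<dots> \<le> (\<Sum>\<^sub>\<infinity>t. B\<^sup>2 * (norm (fiber \<xi> t))\<^sup>2)"
    by (intro infsum_mono g fs le)
  also have "\<dots> = (B * norm \<xi>)\<^sup>2"
    using infsumI[OF fiber_has_sum[of \<xi>]] by (simp add: infsum_cmult_right' power_mult_distrib)
  finally show "infsum ?f UNIV \<le> (B * norm \<xi>)\<^sup>2" .
qed

lemma coord_block_diag:
  fixes T :: "'g \<Rightarrow> 'x op"
  assumes "bounded (range T)"
  shows "coord (blinfun_apply (block_diag T) \<xi>) (t, x) = coord (blinfun_apply (T t) (fiber \<xi> t)) x"
proof -
  obtain B where B: "\<And>t. norm (T t) \<le> B"
    using assms unfolding bounded_iff by auto
  have B0: "0 \<le> B"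
    using B[of undefined] norm_ge_zero order_trans by blast
  define F where "F \<xi> = Abs_ell2 (\<lambda>(t, x). coord (blinfun_apply (T t) (fiber \<xi> t)) x)" for \<xi>
  have cF: "coord (F \<xi>) = (\<lambda>(t, x). coord (blinfun_apply (T t) (fiber \<xi> t)) x)" for \<xi>
    unfolding F_def by (rule Abs_ell2_inverse) (use block_diag_aux(1)[OF B] in simp)
  have fa: "fiber (\<xi> + \<eta>) t = fiber \<xi> t + fiber \<eta> t"
    and fr: "fiber (r *\<^sub>R \<xi>) t = r *\<^sub>R fiber \<xi> t" for \<xi> \<eta> :: "('g \<times> 'x) ell2" and r t
    by (transfer; simp)+
  have "bounded_linear F"
  proof (rule bounded_linear_intro[where K = B])
    show "F (\<xi> + \<eta>) = F \<xi> + F \<eta>" for \<xi> \<eta>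
      by (rule ell2_eqI) (auto simp: cF plus_ell2.rep_eq fa blinfun.add_right split: prod.split)
    show "F (r *\<^sub>R \<xi>) = r *\<^sub>R F \<xi>" for r \<xi>
      by (rule ell2_eqI) (auto simp: cF scaleR_ell2.rep_eq fr blinfun.scaleR_right split: prod.split)
    show "norm (F \<xi>) \<le> norm \<xi> * B" for \<xi>
    proof (rule power2_le_imp_le)
      show "(norm (F \<xi>))\<^sup>2 \<le> (norm \<xi> * B)\<^sup>2"
        using block_diag_aux(2)[of T B \<xi>, OF B] by (simp add: norm_ell2_sq[of "F \<xi>"] cF mult.commute)
    qed (use B0 in simp)
  qed
  then show ?thesis
    unfolding block_diag_def F_def[symmetric] by (simp add: bounded_linear_Blinfun_apply cF)
qed

lemma coord_translation:
  "coord (blinfun_apply (translation s) \<xi>) (t, x) = coord \<xi> (- s + t, x)"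
proof -
  define h :: "'a \<times> 'b \<Rightarrow> 'a \<times> 'b" where "h = (\<lambda>(t, x). (- s + t, x))"
  have h: "bij h"
    by (rule bij_betw_byWitness[where f' = "\<lambda>(t, x). (s + t, x)"]) (auto simp: h_def add.assoc[symmetric])
  define F where "F \<xi> = Abs_ell2 (\<lambda>(t, x). coord \<xi> (- s + t, x))" for \<xi> :: "('a \<times> 'b) ell2"
  have cF: "coord (F \<xi>) = (\<lambda>p. coord \<xi> (h p))" for \<xi>
  proof -
    have "(\<lambda>p. (cmod (coord \<xi> (h p)))\<^sup>2) summable_on UNIV"
      using summable_on_reindex_bij_betw[OF h, of "\<lambda>p. (cmod (coord \<xi> p))\<^sup>2"] coord_summable[of \<xi>]
      by simp
    then have "coord (Abs_ell2 (\<lambda>p. coord \<xi> (h p))) = (\<lambda>p. coord \<xi> (h p))"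
      by (intro Abs_ell2_inverse) simp
    moreover have "(\<lambda>p. coord \<xi> (h p)) = (\<lambda>(t, x). coord \<xi> (- s + t, x))"
      by (auto simp: h_def)
    ultimately show ?thesis
      unfolding F_def by simp
  qed
  have "(norm (F \<xi>))\<^sup>2 = (norm \<xi>)\<^sup>2" for \<xi>
    unfolding norm_ell2_sq cF
    using infsum_reindex_bij_betw[OF h, of "\<lambda>p. (cmod (coord \<xi> p))\<^sup>2"] by simp
  then have "norm (F \<xi>) = norm \<xi>" for \<xi>
    by (simp add: power2_eq_iff_nonneg)
  then have "bounded_linear F"
    by (intro bounded_linear_intro[where K = 1] ell2_eqI)
      (auto simp: cF plus_ell2.rep_eq scaleR_ell2.rep_eq)
  then show ?thesis
    unfolding translation_def F_def[symmetric] by (simp add: bounded_linear_Blinfun_apply cF h_def)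
qed


section \<open>Reduced crossed products\<close>

text \<open>
  Groups are types of class \<open>group_add\<close>, which does not assume commutativity; so a product \<open>s\<inverse>t\<close>
  is written \<open>- s + t\<close>.

  For an action \<open>\<alpha>\<close> of \<open>G\<close> on \<open>A\<close> and a faithful representation \<open>\<rho>\<close> of \<open>A\<close> on \<open>\<ell>\<^sup>2(X)\<close>, the regular
  representation on \<open>\<ell>\<^sup>2(G, \<ell>\<^sup>2(X))\<close> is given by \<open>(\<pi>(a)\<xi>)(t) = \<rho>(\<alpha>\<^bsub>t\<inverse>\<^esub>(a)) \<xi>(t)\<close> and
  \<open>(\<lambda>\<^sub>s\<xi>)(t) = \<xi>(s\<inverse>t)\<close>. The reduced crossed product is the norm closure of the set of all finite
  sums \<open>\<Sum> \<pi>(a\<^sub>s) \<lambda>\<^sub>s\<close>; up to isomorphism it does not depend on the choice of \<open>\<rho>\<close>.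
\<close>

definition regular_rep ::
  "('g::group_add \<Rightarrow> 'e \<Rightarrow> 'e) \<Rightarrow> ('e \<Rightarrow> 'x op) \<Rightarrow> 'e \<Rightarrow> ('g \<times> 'x) op" where
  "regular_rep \<alpha> \<rho> a = block_diag (\<lambda>t. \<rho> (\<alpha> (- t) a))"

definition algebraic_crossed_product ::
  "('e, 'm) cstar_scheme \<Rightarrow> ('g::group_add \<Rightarrow> 'e \<Rightarrow> 'e) \<Rightarrow> ('e \<Rightarrow> 'x op) \<Rightarrow> ('g \<times> 'x) op set" where
  "algebraic_crossed_product A \<alpha> \<rho> =
     {\<Sum>s\<in>F. regular_rep \<alpha> \<rho> (a s) o\<^sub>L translation s | F a. finite F \<and> (\<forall>s\<in>F. a s \<in> carrier A)}"

definition reduced_crossed_product ::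
  "('e, 'm) cstar_scheme \<Rightarrow> ('g::group_add \<Rightarrow> 'e \<Rightarrow> 'e) \<Rightarrow> ('e \<Rightarrow> 'x op) \<Rightarrow> ('g \<times> 'x) op cstar" where
  "reduced_crossed_product A \<alpha> \<rho> =
     op_algebra\<lparr>carrier := closure (algebraic_crossed_product A \<alpha> \<rho>)\<rparr>"


section \<open>The algebra \<open>\<ell>\<^sup>\<infinity>(G, \<K>)\<close> and the Roe algebra\<close>

text \<open>\<open>\<K>\<close> is realised as the algebra of compact operators on \<open>\<ell>\<^sup>2(\<nat>)\<close>.\<close>

definition linf_compact :: "('g \<Rightarrow> nat op) cstar" where
  "linf_compact = \<lparr>
     carrier = {f. range f \<subseteq> compact_ops \<and> bounded (range f)},
     add = (\<lambda>f g s. f s + g s),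
     scale = (\<lambda>c f s. op_scale c (f s)),
     mult = (\<lambda>f g s. f s o\<^sub>L g s),
     star = (\<lambda>f s. adjoint_op (f s)),
     cnorm = (\<lambda>f. SUP s. norm (f s))\<rparr>"

definition left_translation :: "'g::group_add \<Rightarrow> ('g \<Rightarrow> 'e) \<Rightarrow> 'g \<Rightarrow> 'e" where
  "left_translation t f = (\<lambda>s. f (- t + s))"

text \<open>The faithful representation of \<open>\<ell>\<^sup>\<infinity>(G, \<K>)\<close> used here is the one by block diagonal operators
  on \<open>\<ell>\<^sup>2(G, \<ell>\<^sup>2(\<nat>))\<close>.\<close>

definition roe_algebra :: "('g::group_add \<times> 'g \<times> nat) op cstar" where
  "roe_algebra = reduced_crossed_product linf_compact left_translation block_diag"

end

theory Submission
  imports Defs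
begin

text \<open>
  In an algebra with self-adjoint idempotents \<open>p\<^sub>i\<close> such that every \<open>a\<close> is a limit of elements
  \<open>p\<^sub>i a\<close>, every dense ideal contains all \<open>p\<^sub>i\<close> by a Neumann series argument, so the Pedersen ideal
  is spanned by the elements \<open>a p\<^sub>i b\<close>; by Cauchy--Schwarz a trace vanishing at all \<open>p\<^sub>i\<close> is zero.
  Both algebras have such idempotents, indexed by functions \<open>m : G \<rightarrow> \<nat>\<close>: the fields \<open>P\<^sub>m\<close> of
  projections onto the first \<open>m(s)\<close> basis vectors. The value \<open>\<mu>(m) = \<tau>(P\<^sub>m)\<close> is additive in \<open>m\<close>,
  because \<open>P\<^bsub>m+n\<^esub> - P\<^sub>m\<close> is equivalent to \<open>P\<^sub>n\<close> by a field of shifts, and it is translation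
  invariant. Since \<open>\<mu>(1)\<close> is finite and \<open>G\<close> is infinite, finitely supported functions have mass
  zero. For an injection \<open>\<iota> : G \<rightarrow> \<nat>\<close> and every \<open>k\<close> the function \<open>\<iota> m\<close> dominates \<open>k m\<close> off a
  finite set, so \<open>k \<mu>(m) \<le> \<mu>(\<iota> m)\<close> and hence \<open>\<mu>(m) = 0\<close>.
\<close>


section \<open>The Pedersen ideal of an algebra with an approximate unit of projections\<close>

text \<open>Completeness enters only through \<open>perturbed_idempotent\<close>. If v is the
  quasi-inverse of e - x, then 1 + v is formally inverse to 1 - (e - x), and multiplying by e leaves
  e = (1 + v) x e; the axiom expands this product because the carrier need not contain a
  unit.\<close>

locale projection_algebra =
  fixes A :: "('e, 'm) cstar_scheme" and p :: "'i \<Rightarrow> 'e"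
  assumes add_closed: "x \<in> carrier A \<Longrightarrow> y \<in> carrier A \<Longrightarrow> add A x y \<in> carrier A"
    and scale_closed: "x \<in> carrier A \<Longrightarrow> scale A c x \<in> carrier A"
    and mult_closed: "x \<in> carrier A \<Longrightarrow> y \<in> carrier A \<Longrightarrow> mult A x y \<in> carrier A"
    and star_closed: "x \<in> carrier A \<Longrightarrow> star A x \<in> carrier A"
    and mult_assoc: "\<lbrakk>x \<in> carrier A; y \<in> carrier A; z \<in> carrier A\<rbrakk> \<Longrightarrow>
      mult A (mult A x y) z = mult A x (mult A y z)"
    and mult_add_left: "\<lbrakk>x \<in> carrier A; y \<in> carrier A; z \<in> carrier A\<rbrakk> \<Longrightarrow>
      mult A (add A x y) z = add A (mult A x z) (mult A y z)"
    and mult_add_right: "\<lbrakk>x \<in> carrier A; y \<in> carrier A; z \<in> carrier A\<rbrakk> \<Longrightarrow>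
      mult A x (add A y z) = add A (mult A x y) (mult A x z)"
    and mult_scale_left: "\<lbrakk>x \<in> carrier A; y \<in> carrier A\<rbrakk> \<Longrightarrow>
      mult A (scale A c x) y = scale A c (mult A x y)"
    and mult_scale_right: "\<lbrakk>x \<in> carrier A; y \<in> carrier A\<rbrakk> \<Longrightarrow>
      mult A x (scale A c y) = scale A c (mult A x y)"
    and scale_add: "\<lbrakk>x \<in> carrier A; y \<in> carrier A\<rbrakk> \<Longrightarrow>
      scale A c (add A x y) = add A (scale A c x) (scale A c y)"
    and star_add: "\<lbrakk>x \<in> carrier A; y \<in> carrier A\<rbrakk> \<Longrightarrow>
      star A (add A x y) = add A (star A x) (star A y)"
    and star_scale: "x \<in> carrier A \<Longrightarrow> star A (scale A c x) = scale A (cnj c) (star A x)"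
    and star_mult: "\<lbrakk>x \<in> carrier A; y \<in> carrier A\<rbrakk> \<Longrightarrow>
      star A (mult A x y) = mult A (star A y) (star A x)"
    and star_star: "x \<in> carrier A \<Longrightarrow> star A (star A x) = x"
    and perturbed_idempotent: "\<lbrakk>e \<in> carrier A; mult A e e = e; x \<in> carrier A;
      cnorm A (add A e (scale A (-1) x)) < 1\<rbrakk> \<Longrightarrow>
      \<exists>v\<in>carrier A. e = add A (mult A x e) (mult A v (mult A x e))"
    and p_closed: "p i \<in> carrier A"
    and p_idem: "mult A (p i) (p i) = p i"
    and p_star: "star A (p i) = p i"
    and p_approx: "\<lbrakk>a \<in> carrier A; 0 < \<epsilon>\<rbrakk> \<Longrightarrow>
      \<exists>i. cnorm A (add A a (scale A (-1) (mult A (p i) a))) < \<epsilon>"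
begin

text \<open>Scalars can be absorbed into the left factor a, so closure under sums alone already
  gives a two-sided ideal.\<close>

inductive_set pideal :: "'e set" where
  gen: "\<lbrakk>a \<in> carrier A; b \<in> carrier A\<rbrakk> \<Longrightarrow> mult A a (mult A (p i) b) \<in> pideal"
| add: "\<lbrakk>x \<in> pideal; y \<in> pideal\<rbrakk> \<Longrightarrow> add A x y \<in> pideal"

lemma pideal_carrier: "x \<in> pideal \<Longrightarrow> x \<in> carrier A"
  by (induction rule: pideal.induct) (auto intro: mult_closed add_closed p_closed)

lemma pideal_scale: "x \<in> pideal \<Longrightarrow> scale A c x \<in> pideal"
proof (induction rule: pideal.induct)
  case (gen a b i)
  then show ?case
    using pideal.gen[OF scale_closed[of a c] gen(2), of i] by (simp add: mult_scale_left mult_closed p_closed)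
next
  case (add x y)
  then show ?case
    using pideal.add by (simp add: scale_add pideal_carrier)
qed

lemma pideal_mult_left: "x \<in> pideal \<Longrightarrow> a \<in> carrier A \<Longrightarrow> mult A a x \<in> pideal"
proof (induction rule: pideal.induct)
  case (gen b c i)
  then show ?case
    using pideal.gen[OF mult_closed[of a b] gen(2), of i] by (simp add: mult_assoc mult_closed p_closed)
next
  case (add x y)
  then show ?case
    using pideal.add by (simp add: mult_add_right pideal_carrier)
qed

lemma pideal_mult_right: "x \<in> pideal \<Longrightarrow> a \<in> carrier A \<Longrightarrow> mult A x a \<in> pideal"
proof (induction rule: pideal.induct)
  case (gen b c i)
  then show ?case
    using pideal.gen[OF gen(1) mult_closed[of c a], of i] by (simp add: mult_assoc mult_closed p_closed)
next
  case (add x y)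
  then show ?case
    using pideal.add by (simp add: mult_add_left pideal_carrier)
qed

text \<open>Idempotence supplies the missing left factor: p_i a = p_i (p_i a).\<close>

lemma p_mult_pideal: "a \<in> carrier A \<Longrightarrow> mult A (p i) a \<in> pideal"
  using pideal.gen[OF p_closed[of i], of a i] mult_assoc[OF p_closed p_closed, of a i i]
  by (simp add: p_idem)

lemma p_pideal: "p i \<in> pideal"
  using p_mult_pideal[OF p_closed[of i], of i] by (simp add: p_idem)

lemma pideal_ideal: "two_sided_ideal A pideal"
  unfolding two_sided_ideal_def
  by (intro conjI ballI allI subsetI) (use p_pideal in \<open>auto intro: pideal_carrier pideal.add pideal_scale pideal_mult_left pideal_mult_right\<close>)

lemma pideal_dense: "dense_in A pideal"
  unfolding dense_in_def using p_approx p_mult_pideal by blast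

text \<open>Density gives x in the ideal at distance less than 1 from e. In the resulting formula e
  = x e + v x e every term contains the factor x.\<close>

lemma idempotent_in_dense_ideal:
  assumes I: "two_sided_ideal A I" "dense_in A I" and e: "e \<in> carrier A" "mult A e e = e"
  shows "e \<in> I"
proof -
  obtain x where x: "x \<in> I" "cnorm A (add A e (scale A (-1) x)) < 1"
    using I(2) e unfolding dense_in_def by (metis zero_less_one)
  then obtain v where "v \<in> carrier A" "e = add A (mult A x e) (mult A v (mult A x e))"
    using perturbed_idempotent[OF e, of x] I(1) unfolding two_sided_ideal_def by blast
  then show ?thesis
    using I(1) x(1) e(1) unfolding two_sided_ideal_def by metis
qed

text \<open>Minimality holds because each dense ideal contains all the idempotents p_i, hence all
  generators a p_i b; density of \<open>pideal\<close> itself is \<open>p_approx\<close>.\<close>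

lemma Ped_eq: "Ped A = pideal"
  unfolding Ped_def
proof (rule Least_equality)
  show "two_sided_ideal A pideal \<and> dense_in A pideal"
    using pideal_ideal pideal_dense by blast
  fix I assume I: "two_sided_ideal A I \<and> dense_in A I"
  then have p: "p i \<in> I" for i
    using idempotent_in_dense_ideal[of I "p i"] p_closed p_idem by blast
  have "x \<in> I" if "x \<in> pideal" for x
    using that
  proof induction
    case (gen a b i)
    then show ?case
      using I p[of i] unfolding two_sided_ideal_def by blast
  next
    case (add x y)
    then show ?case
      using I unfolding two_sided_ideal_def by blast
  qed
  then show "pideal \<subseteq> I"
    by blast
qed

section \<open>Traces and their vanishing on the Pedersen ideal\<close>

context
  fixes \<tau> :: "'e \<Rightarrow> complex"
  assumes tr: "densely_defined_lsc_trace A \<tau>"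
begin

lemma trace_add: "x \<in> pideal \<Longrightarrow> y \<in> pideal \<Longrightarrow> \<tau> (add A x y) = \<tau> x + \<tau> y"
  and trace_scale: "x \<in> pideal \<Longrightarrow> \<tau> (scale A c x) = c * \<tau> x"
  and trace_comm: "x \<in> carrier A \<Longrightarrow> mult A (star A x) x \<in> pideal \<Longrightarrow>
     \<tau> (mult A (star A x) x) = \<tau> (mult A x (star A x))"
  and trace_pos: "x \<in> carrier A \<Longrightarrow> mult A (star A x) x \<in> pideal \<Longrightarrow> \<tau> (mult A (star A x) x) \<in> \<real>\<^sub>\<ge>\<^sub>0"
  using tr unfolding densely_defined_lsc_trace_def Ped_eq positive_elements_def by blast+

text \<open>The degenerate case of the Cauchy--Schwarz inequality for the form \<open>\<tau> (x* y)\<close>.\<close>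

lemma trace_null:
  assumes x: "x \<in> pideal" and y: "y \<in> pideal" and null: "\<tau> (mult A (star A y) y) = 0"
  shows "\<tau> (mult A (star A x) y) = 0"
proof -
  note c = pideal_carrier[OF x] pideal_carrier[OF y]
  note sc = star_closed[OF c(1)] star_closed[OF c(2)]
  define r w w' where "r = \<tau> (mult A (star A x) x)" and "w = \<tau> (mult A (star A x) y)"
    and "w' = \<tau> (mult A (star A y) x)"
  \<comment> \<open>This is the trace of s* s for s = x + z y; the term quadratic in z drops out by
    \<open>null\<close>. Hermitian symmetry of the form has not been established, so
    \<open>w'\<close> is kept as a separate unknown.\<close>
  have *: "r + z * w + cnj z * w' \<in> \<real>\<^sub>\<ge>\<^sub>0" for z
  proof -
    let ?y = "scale A z y" and ?s = "add A x (scale A z y)"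
    have y': "?y \<in> pideal" and s: "?s \<in> pideal"
      using x y by (auto intro: pideal_scale pideal.add)
    note cy = pideal_carrier[OF y'] pideal_carrier[OF s] star_closed[OF pideal_carrier[OF y']]
    have "mult A (star A ?s) ?s = add A (mult A (star A x) ?s) (mult A (star A ?y) ?s)"
      using c cy sc by (simp add: star_add mult_add_left)
    then have "\<tau> (mult A (star A ?s) ?s) = \<tau> (mult A (star A x) ?s) + \<tau> (mult A (star A ?y) ?s)"
      using trace_add pideal_mult_left[OF s] sc cy by simp
    also have "mult A (star A x) ?s = add A (mult A (star A x) x) (scale A z (mult A (star A x) y))"
      using c cy sc by (simp add: mult_add_right mult_scale_right)
    also have "\<tau> \<dots> = r + z * w"
      unfolding r_def w_def using pideal_mult_left[OF x sc(1)] pideal_mult_left[OF y sc(1)]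
      by (simp add: trace_add trace_scale pideal_scale)
    also have "mult A (star A ?y) ?s = scale A (cnj z) (mult A (star A y) ?s)"
      using c cy sc by (simp add: star_scale mult_scale_left)
    also have "mult A (star A y) ?s = add A (mult A (star A y) x) (scale A z (mult A (star A y) y))"
      using c cy sc by (simp add: mult_add_right mult_scale_right)
    also have "\<tau> (scale A (cnj z) \<dots>) = cnj z * w'"
      using pideal_mult_left[OF x sc(2)] pideal_mult_left[OF y sc(2)] null unfolding w'_def
      by (simp add: trace_add trace_scale pideal_scale pideal.add)
    finally show ?thesis
      using trace_pos[OF cy(2) pideal_mult_left[OF s star_closed[OF cy(2)]]] by simp
  qed
  have zero: "z * w + cnj z * w' = 0" for z
  proof -
    have r: "r \<in> \<real>\<^sub>\<ge>\<^sub>0"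
      using *[of 0] by simp
    define u where "u = z * w + cnj z * w'"
    have t: "r + of_real t * u \<in> \<real>\<^sub>\<ge>\<^sub>0" for t
      using *[of "of_real t * z"] unfolding u_def by (simp add: algebra_simps)
    have im: "Im u = 0"
      using t[of 1] r by (simp add: complex_nonneg_Reals_iff)
    have "0 \<le> Re r + t * Re u" for t
      using t[of t] by (simp add: complex_nonneg_Reals_iff)
    \<comment> \<open>With Re u nonzero, this value of t would turn the nonnegative expression into
      -1.\<close>
    from this[of "- (Re r + 1) / Re u"] have "Re u = 0"
      by (cases "Re u = 0") auto
    with im show ?thesis
      unfolding u_def[symmetric] by (simp add: complex_eq_iff)
  qed
  \<comment> \<open>The choices z = 1 and z = \<i> decouple the two unknowns.\<close>
  have "w + w' = 0" "\<i> * w - \<i> * w' = 0"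
    using zero[of 1] zero[of \<i>] by auto
  then have "w + w' = 0" "w - w' = 0"
    by (simp_all flip: right_diff_distrib)
  then have "w = 0"
    by simp
  then show ?thesis
    unfolding w_def .
qed

text \<open>\<open>trace_null\<close> is applied twice: with y = p_i it kills all products z p_i,
  and these in turn show that y = p_i b is null, which kills the generators a p_i b.\<close>

lemma trace_zero:
  assumes p0: "\<And>i. \<tau> (p i) = 0" and x: "x \<in> Ped A"
  shows "\<tau> x = 0"
proof -
  \<comment> \<open>The left argument of the form must lie in the ideal, hence x = p_i z*, for which
    x* p_i = z p_i p_i = z p_i.\<close>
  have zp: "\<tau> (mult A z (p i)) = 0" if z: "z \<in> carrier A" for z i
  proof -
    have "\<tau> (mult A (star A (mult A (p i) (star A z))) (p i)) = 0"
      by (rule trace_null) (use z in \<open>auto intro: p_mult_pideal p_pideal star_closed simp: p_star p_idem p0\<close>)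
    then show ?thesis
      using z by (simp add: star_mult star_closed p_closed star_star p_star mult_assoc p_idem)
  qed
  \<comment> \<open>For y = p_i b the traces of y* y and y y* agree, and y y* has the form z p_i
    with z = p_i b b*. Pairing y with p_i a* then produces a p_i b.\<close>
  have gen: "\<tau> (mult A a (mult A (p i) b)) = 0" if a: "a \<in> carrier A" and b: "b \<in> carrier A" for a b i
  proof -
    let ?y = "mult A (p i) b"
    note cl = mult_closed star_closed p_closed a b
    have y: "?y \<in> pideal"
      using b by (rule p_mult_pideal)
    have "\<tau> (mult A (star A ?y) ?y) = \<tau> (mult A ?y (star A ?y))"
      using cl by (intro trace_comm pideal_mult_left[OF y]) auto
    also have "mult A ?y (star A ?y) = mult A (mult A ?y (star A b)) (p i)"
      using cl by (simp add: star_mult p_star mult_assoc)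
    also have "\<tau> \<dots> = 0"
      using cl by (intro zp) auto
    finally have "\<tau> (mult A (star A (mult A (p i) (star A a))) ?y) = 0"
      by (rule trace_null[OF p_mult_pideal[OF star_closed[OF a]] y])
    moreover have "mult A (p i) (mult A (p i) b) = mult A (p i) b"
      using cl by (simp add: mult_assoc[symmetric] p_idem)
    ultimately show ?thesis
      using cl by (simp add: star_mult star_star p_star mult_assoc)
  qed
  show ?thesis
    using x unfolding Ped_eq by induction (auto simp: gen trace_add)
qed

end

end


section \<open>Additive masses on functions from a countably infinite set to the naturals\<close>

text \<open>Of translation invariance only the equality of all singleton masses is kept. Infinitude
  forces this common mass to vanish, since the mass of the constant 1 is finite; countability
  supplies an unbounded weight that is small only on finite sets.\<close>

lemma additive_mass_zero:
  fixes \<mu> :: "('g \<Rightarrow> nat) \<Rightarrow> real"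
  assumes count: "countable (UNIV :: 'g set)" and inf: "infinite (UNIV :: 'g set)"
    and add: "\<And>m n. \<mu> (\<lambda>s. m s + n s) = \<mu> m + \<mu> n"
    and nonneg: "\<And>m. 0 \<le> \<mu> m"
    and points: "\<And>s t. \<mu> (indicator {s}) = \<mu> (indicator {t})"
  shows "\<mu> m = 0"
proof -
  have zero: "\<mu> (\<lambda>_. 0) = 0"
    using add[of "\<lambda>_. 0" "\<lambda>_. 0"] by simp
  \<comment> \<open>Truncated subtraction is exact here, so n splits as m + (n - m).\<close>
  have mono: "\<mu> m \<le> \<mu> n" if "\<And>s. m s \<le> n s" for m n
    using add[of m "\<lambda>s. n s - m s"] nonneg[of "\<lambda>s. n s - m s"] that by simp
  have mult: "\<mu> (\<lambda>s. k * m s) = k * \<mu> m" for k m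
    by (induction k) (simp_all add: zero add algebra_simps)
  define c where "c = \<mu> (indicator {undefined})"
  have ind: "\<mu> (indicator F) = card F * c" if "finite F" for F
    using that
  proof induction
    case empty
    then show ?case by (simp add: zero indicator_def)
  next
    case (insert s F)
    have "indicator (insert s F) = (\<lambda>t. indicator {s} t + indicator F t :: nat)"
      using insert(2) by (auto simp: indicator_def)
    then show ?case
      using insert add[of "indicator {s}" "indicator F"] points[of s undefined]
      by (simp add: c_def algebra_simps)
  qed
  \<comment> \<open>Otherwise a set of k points with k c above the mass of the constant 1 would
    contradict monotonicity.\<close>
  have "c = 0"
  proof (rule ccontr)
    assume "c \<noteq> 0"
    then have c: "0 < c"
      using nonneg[of "indicator {undefined}"] unfolding c_def by simp
    then obtain k :: nat where "\<mu> (\<lambda>_. 1) < k * c"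
      using reals_Archimedean3 by blast
    moreover obtain F :: "'g set" where "finite F" "card F = k"
      using inf infinite_arbitrarily_large by blast
    moreover have "\<mu> (indicator F) \<le> \<mu> (\<lambda>_. 1)"
      by (rule mono) (simp add: indicator_def)
    ultimately show False
      using ind[of F] by simp
  qed
  \<comment> \<open>Pointwise n is at most its maximum times the indicator of its support, whose
    mass is a multiple of c.\<close>
  have fin: "\<mu> n = 0" if n: "finite {s. n s \<noteq> 0}" for n
  proof -
    let ?F = "{s. n s \<noteq> 0}"
    have "n s \<le> Max (n ` ?F) * indicator ?F s" for s
      using n by (auto simp: indicator_def)
    then have "\<mu> n \<le> \<mu> (\<lambda>s. Max (n ` ?F) * indicator ?F s)"
      by (rule mono)
    then show ?thesis
      using nonneg[of n] ind[OF n] \<open>c = 0\<close> by (simp add: mult)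
  qed
  define idx :: "'g \<Rightarrow> nat" where "idx = to_nat_on UNIV"
  have idx: "inj idx"
    unfolding idx_def using count by (rule inj_on_to_nat_on)
  have le: "k * \<mu> m \<le> \<mu> (\<lambda>s. idx s * m s)" for k :: nat
  proof -
    \<comment> \<open>The correction \<open>?n\<close> restores the inequality k m \<le>
      \<open>idx\<close> m + \<open>?n\<close> at the finitely many points of index below k and
      carries no mass.\<close>
    let ?n = "\<lambda>s. if idx s < k then k * m s else 0"
    have "finite {s. idx s < k}"
      using finite_vimageI[OF finite_lessThan[of k] idx] by (simp add: vimage_def)
    then have 0: "\<mu> ?n = 0"
      by (intro fin) (auto elim: finite_subset[rotated])
    have "k * \<mu> m = \<mu> (\<lambda>s. k * m s)"
      by (simp add: mult)
    also have "\<dots> \<le> \<mu> (\<lambda>s. idx s * m s + ?n s)"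
      by (rule mono) auto
    also have "\<dots> = \<mu> (\<lambda>s. idx s * m s)"
      by (simp only: add 0)
    finally show ?thesis .
  qed
  show ?thesis
  proof (rule ccontr)
    assume "\<mu> m \<noteq> 0"
    then have "0 < \<mu> m"
      using nonneg[of m] by simp
    then obtain k :: nat where "\<mu> (\<lambda>s. idx s * m s) < k * \<mu> m"
      using reals_Archimedean3 by blast
    with le[of k] show False
      by simp
  qed
qed


text \<open>The element v is a Murray--von Neumann equivalence between p_n and the complement of p_m
  in the projection for m + n. The clause v p_n = v serves to place v v* in the Pedersen
  ideal.\<close>

locale rank_algebra = projection_algebra A p
  for A :: "('e, 'm) cstar_scheme" and p :: "('g \<Rightarrow> nat) \<Rightarrow> 'e" +
  assumes p_add: "\<exists>v\<in>carrier A. mult A (star A v) v = p n \<and> mult A v (p n) = v \<and>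
      p (\<lambda>s. m s + n s) = add A (p m) (mult A v (star A v))"
begin

text \<open>The real part of \<open>\<tau> (p m)\<close> is the mass fed to
  \<open>additive_mass_zero\<close>, and \<open>trace_zero\<close> spreads the vanishing from
  projections to the whole Pedersen ideal. The two algebras differ in the source of
  \<open>points\<close>: an invariance assumption for one, equivalence via translations for the
  other.\<close>

lemma no_trace:
  assumes count: "countable (UNIV :: 'g set)" and inf: "infinite (UNIV :: 'g set)"
    and tr: "densely_defined_lsc_trace A \<tau>"
    and points: "\<And>s t. \<tau> (p (indicator {s})) = \<tau> (p (indicator {t}))"
  shows "\<not> nonzero_trace A \<tau>"
proof -
  have pos: "\<tau> (p m) \<in> \<real>\<^sub>\<ge>\<^sub>0" for m
    using trace_pos[OF tr p_closed[of m]] p_pideal[of m] by (simp add: p_star p_idem)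
  have "\<tau> (p (\<lambda>s. m s + n s)) = \<tau> (p m) + \<tau> (p n)" for m n
  proof -
    obtain v where v: "v \<in> carrier A" "mult A (star A v) v = p n" "mult A v (p n) = v"
      "p (\<lambda>s. m s + n s) = add A (p m) (mult A v (star A v))"
      using p_add by blast
    \<comment> \<open>Inserting p_n between v and v* exhibits v v* as a generator of the ideal, so
      that \<open>trace_add\<close> applies.\<close>
    have "mult A v (mult A (p n) (star A v)) = mult A v (star A v)"
      using v mult_assoc[of v "p n" "star A v"] by (simp add: p_closed star_closed)
    then have "mult A v (star A v) \<in> pideal"
      using pideal.gen[OF v(1) star_closed[OF v(1)], of n] by simp
    then show ?thesis
      using v trace_comm[OF tr v(1)] p_pideal trace_add[OF tr] by simp
  qed
  then have "Re (\<tau> (p m)) = 0" for m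
    by (intro additive_mass_zero[OF count inf, of "\<lambda>m. Re (\<tau> (p m))"])
      (use pos points in \<open>auto simp: complex_nonneg_Reals_iff\<close>, metis)
  then have "\<tau> (p m) = 0" for m
    using pos[of m] by (simp add: complex_nonneg_Reals_iff complex_eq_iff)
  then show ?thesis
    unfolding nonzero_trace_def using trace_zero[OF tr] by blast
qed

end


section \<open>Completeness of \<open>\<ell>\<^sup>2\<close> and the complex inner product\<close>

lemmas coord_simps = zero_ell2.rep_eq plus_ell2.rep_eq uminus_ell2.rep_eq minus_ell2.rep_eq
  scaleR_ell2.rep_eq scaleC.rep_eq fiber.rep_eq

lemma sum_coord_le: "finite F \<Longrightarrow> (\<Sum>i\<in>F. (cmod (coord x i))\<^sup>2) \<le> (norm x)\<^sup>2"
  unfolding norm_ell2_sq by (rule finite_sum_le_infsum[OF coord_summable]) auto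

lemma norm_coord_le: "cmod (coord x i) \<le> norm x"
  using sum_coord_le[of "{i}" x] by (simp add: power2_le_iff_abs_le)

text \<open>Nonnegative families with bounded finite sums are summable. This is the tool for
  building vectors from coordinates, for limits of Cauchy sequences and for adjoints.\<close>

lemma ell2_bounded_sums:
  assumes B: "0 \<le> B" "\<And>F. finite F \<Longrightarrow> (\<Sum>i\<in>F. (cmod (f i))\<^sup>2) \<le> B\<^sup>2"
  obtains x where "coord x = f" "norm x \<le> B"
proof -
  have s: "(\<lambda>i. (cmod (f i))\<^sup>2) summable_on UNIV"
    by (rule nonneg_bdd_above_summable_on) (auto intro!: bdd_aboveI[of _ "B\<^sup>2"] B)
  then have x: "coord (Abs_ell2 f) = f"
    by (intro Abs_ell2_inverse) simp
  have "(norm (Abs_ell2 f))\<^sup>2 \<le> B\<^sup>2"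
    unfolding norm_ell2_sq x by (rule infsum_le_finite_sums[OF s]) (simp add: B)
  then have "norm (Abs_ell2 f) \<le> B"
    using B(1) by (rule power2_le_imp_le)
  with x that show ?thesis
    by blast
qed

text \<open>The coordinatewise limit is the norm limit. Completeness is what makes Neumann series of
  operators converge and turns total boundedness into compactness.\<close>

instance ell2 :: (type) banach
proof
  fix X :: "nat \<Rightarrow> 'a ell2"
  assume X: "Cauchy X"
  have "Cauchy (\<lambda>n. coord (X n) i)" for i
    unfolding Cauchy_altdef2
  proof (intro allI impI)
    fix e :: real assume "0 < e"
    then obtain N where "\<And>n. n \<ge> N \<Longrightarrow> norm (X n - X N) < e"
      using X unfolding Cauchy_altdef2 dist_norm by blast
    then show "\<exists>N. \<forall>n\<ge>N. dist (coord (X n) i) (coord (X N) i) < e"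
      unfolding dist_norm using norm_coord_le[of "X _ - X _" i]
      by (metis minus_ell2.rep_eq order.strict_trans1)
  qed
  then obtain f where f: "\<And>i. (\<lambda>n. coord (X n) i) \<longlonglongrightarrow> f i"
    unfolding Cauchy_convergent_iff convergent_def by metis
  \<comment> \<open>A Fatou argument: on each finite set of coordinates m tends to infinity in the
    bound for X n - X m.\<close>
  have lim: "\<exists>y. coord y = (\<lambda>i. coord (X n) i - f i) \<and> norm y \<le> e"
    if N: "\<And>m n. m \<ge> N \<Longrightarrow> n \<ge> N \<Longrightarrow> norm (X m - X n) < e" and n: "n \<ge> N" and e: "0 < e" for N n e
  proof -
    have "(\<Sum>i\<in>F. (cmod (coord (X n) i - f i))\<^sup>2) \<le> e\<^sup>2" if F: "finite F" for F
    proof (rule LIMSEQ_le_const2)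
      show "(\<lambda>m. \<Sum>i\<in>F. (cmod (coord (X n) i - coord (X m) i))\<^sup>2) \<longlonglongrightarrow>
          (\<Sum>i\<in>F. (cmod (coord (X n) i - f i))\<^sup>2)"
        by (intro tendsto_intros f)
      have "(\<Sum>i\<in>F. (cmod (coord (X n) i - coord (X m) i))\<^sup>2) \<le> e\<^sup>2" if "m \<ge> N" for m
      proof -
        have "(norm (X n - X m))\<^sup>2 \<le> e\<^sup>2"
          using N[OF n that] by (intro power_mono) auto
        then show ?thesis
          using sum_coord_le[OF F, of "X n - X m"] by (simp add: coord_simps)
      qed
      then show "\<exists>M. \<forall>m\<ge>M. (\<Sum>i\<in>F. (cmod (coord (X n) i - coord (X m) i))\<^sup>2) \<le> e\<^sup>2"
        by blast
    qed
    then obtain y where "coord y = (\<lambda>i. coord (X n) i - f i)" "norm y \<le> e"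
      by (rule ell2_bounded_sums[OF less_imp_le[OF e]]) auto
    then show ?thesis
      by blast
  qed
  have C: "\<exists>N. \<forall>m\<ge>N. \<forall>n\<ge>N. norm (X m - X n) < e" if "0 < e" for e
    using X that unfolding Cauchy_iff by blast
  obtain N where "\<And>m n. m \<ge> N \<Longrightarrow> n \<ge> N \<Longrightarrow> norm (X m - X n) < 1"
    using C[of 1] by auto
  then obtain y where y: "coord y = (\<lambda>i. coord (X N) i - f i)"
    using lim[of N 1 N] by auto
  \<comment> \<open>Square summability of \<open>f\<close> is inherited from this difference, whose
    coordinates are exactly \<open>f\<close>.\<close>
  define x where "x = X N - y"
  have x: "coord x = f"
    unfolding x_def by (simp add: coord_simps y)
  have "X \<longlonglongrightarrow> x"
    unfolding LIMSEQ_iff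
  proof (intro allI impI)
    fix e :: real assume e: "0 < e"
    then obtain N where N: "\<And>m n. m \<ge> N \<Longrightarrow> n \<ge> N \<Longrightarrow> norm (X m - X n) < e / 2"
      using C[of "e / 2"] by auto
    have "norm (X n - x) < e" if n: "n \<ge> N" for n
    proof -
      obtain y where y: "coord y = (\<lambda>i. coord (X n) i - f i)" "norm y \<le> e / 2"
        using lim[OF N n] e by auto
      then have "y = X n - x"
        by (intro ell2_eqI) (simp add: coord_simps x)
      then show ?thesis
        using y(2) e by simp
    qed
    then show "\<exists>N. \<forall>n\<ge>N. norm (X n - x) < e"
      by blast
  qed
  then show "convergent X"
    unfolding convergent_def by blast
qed

section \<open>The complex inner product\<close>

lemma scaleC_add: "scaleC c (x + y) = scaleC c x + scaleC c y"
  and scaleC_scaleC: "scaleC c (scaleC d x) = scaleC (c * d) x"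
  and scaleR_scaleC: "r *\<^sub>R x = scaleC (of_real r) x"
  by (auto intro!: ell2_eqI simp: coord_simps algebra_simps)

lemma cinner_add_left: "cinner (x + y) z = cinner x z + cinner y z"
  unfolding cinner_def by (simp add: coord_simps distrib_right infsum_add cinner_summable)

lemma cinner_scale_left: "cinner (scaleC c x) y = c * cinner x y"
  unfolding cinner_def by (simp add: coord_simps mult.assoc infsum_cmult_right')

lemma cnj_cinner: "cnj (cinner x y) = cinner y x"
  unfolding cinner_def by (subst infsum_cnj[symmetric]) (simp add: mult.commute)

lemma cinner_add_right: "cinner x (y + z) = cinner x y + cinner x z"
  by (metis cinner_add_left cnj_cinner complex_cnj_add)

lemma cinner_scale_right: "cinner x (scaleC c y) = cnj c * cinner x y"
  by (metis cinner_scale_left cnj_cinner complex_cnj_mult)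

lemma Re_cinner: "Re (cinner x y) = inner x y"
  by (simp add: inner_ell2_def)

lemma cinner_self: "cinner x x = of_real ((norm x)\<^sup>2)"
proof -
  have "Im (cinner x x) = 0"
    using cnj_cinner[of x x] by (metis complex_is_Real_iff Reals_cnj_iff)
  then show ?thesis
    by (simp add: complex_eq_iff Re_cinner dot_square_norm)
qed

text \<open>Rotating x by a unimodular scalar makes the inner product real and nonnegative, which
  reduces the claim to the real Cauchy--Schwarz inequality.\<close>

lemma cmod_cinner_le: "cmod (cinner x y) \<le> norm x * norm y"
proof -
  obtain c where c: "cmod c = 1" "c * cinner x y = of_real (cmod (cinner x y))"
  proof (cases "cinner x y = 0")
    case False
    then show ?thesis
      using that[of "cnj (cinner x y) / of_real (cmod (cinner x y))"]
      by (simp add: norm_divide complex_norm_square[symmetric] mult.commute power2_eq_square)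
  qed (use that[of 1] in simp)
  have "cmod (cinner x y) = Re (cinner (scaleC c x) y)"
    unfolding cinner_scale_left c(2) by simp
  also have "\<dots> \<le> norm (scaleC c x) * norm y"
    unfolding Re_cinner by (rule norm_cauchy_schwarz)
  finally show ?thesis
    by (simp add: norm_scaleC c)
qed

lemma bounded_linear_cinner: "bounded_linear (\<lambda>x. cinner x y)"
  by (rule bounded_linear_intro[where K = "norm y"])
    (simp_all add: cinner_add_left scaleR_scaleC cinner_scale_left cmod_cinner_le scaleR_conv_of_real)

lemma cinner_ext: "(\<And>x. cinner x y = cinner x z) \<Longrightarrow> y = z"
proof -
  assume *: "\<And>x. cinner x y = cinner x z"
  have "inner x (y - z) = 0" for x
    using *[of x] unfolding inner_diff_right by (simp flip: Re_cinner)
  from this[of "y - z"] show "y = z"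
    by simp
qed

section \<open>The standard orthonormal basis\<close>

lift_definition ell2_unit :: "'a \<Rightarrow> 'a ell2" is "\<lambda>i j. if j = i then 1 else 0"
  by (subst summable_on_cong_neutral[of "{_}"]) auto

lemma coord_sum: "coord (sum f F) i = (\<Sum>j\<in>F. coord (f j) i)"
  by (induction F rule: infinite_finite_induct) (auto simp: coord_simps)

lemma coord_finite_combination:
  "finite F \<Longrightarrow> coord (\<Sum>j\<in>F. scaleC (c j) (ell2_unit j)) i = (if i \<in> F then c i else 0)"
  by (simp add: coord_sum coord_simps ell2_unit.rep_eq if_distrib cong: if_cong)

text \<open>The squared error of a finite partial sum is the part of the squared norm outside the
  finite set, which tends to 0.\<close>

lemma ell2_unit_has_sum: "((\<lambda>i. scaleC (coord x i) (ell2_unit i)) has_sum x) UNIV"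
proof -
  let ?s = "\<lambda>F. \<Sum>i\<in>F. scaleC (coord x i) (ell2_unit i)" and ?f = "\<lambda>i. (cmod (coord x i))\<^sup>2"
  let ?L = "finite_subsets_at_top UNIV"
  have dist: "(norm (?s F - x))\<^sup>2 = (norm x)\<^sup>2 - sum ?f F" if F: "finite F" for F
  proof -
    have "(norm (?s F - x))\<^sup>2 = infsum ?f (- F)"
      unfolding norm_ell2_sq
      by (rule infsum_cong_neutral) (auto simp: coord_simps coord_finite_combination F)
    moreover have "(norm x)\<^sup>2 = infsum ?f F + infsum ?f (- F)"
      unfolding norm_ell2_sq
      using infsum_Un_disjoint[of ?f F "- F"] summable_on_subset[OF coord_summable[of x]] by simp
    ultimately show ?thesis
      using F by simp
  qed
  have "(?f has_sum (norm x)\<^sup>2) UNIV"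
    unfolding norm_ell2_sq by (rule has_sum_infsum[OF coord_summable])
  then have "((\<lambda>F. (norm x)\<^sup>2 - sum ?f F) \<longlongrightarrow> (norm x)\<^sup>2 - (norm x)\<^sup>2) ?L"
    unfolding has_sum_def by (intro tendsto_intros)
  then have "((\<lambda>F. (norm (?s F - x))\<^sup>2) \<longlongrightarrow> 0) ?L"
    by (simp add: tendsto_cong[OF eventually_finite_subsets_at_top_weakI[OF dist]])
  then have "((\<lambda>F. sqrt ((norm (?s F - x))\<^sup>2)) \<longlongrightarrow> sqrt 0) ?L"
    by (rule tendsto_real_sqrt)
  then have "((\<lambda>F. ?s F - x) \<longlongrightarrow> 0) ?L"
    by (simp add: tendsto_norm_zero_iff)
  then show ?thesis
    unfolding has_sum_def by (rule LIM_zero_cancel)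
qed

section \<open>Coordinate projections and partial isometries\<close>

text \<open>\<open>pull_vec B g\<close> is only meaningful for \<open>g\<close> injective on \<open>B\<close>; otherwise it is \<open>0\<close>.\<close>

lift_definition pull_vec :: "'a set \<Rightarrow> ('a \<Rightarrow> 'b) \<Rightarrow> 'b ell2 \<Rightarrow> 'a ell2"
  is "\<lambda>B g f i. if inj_on g B \<and> i \<in> B then f (g i) else 0"
proof -
  fix B :: "'a set" and g and f :: "'b \<Rightarrow> complex"
  assume f: "(\<lambda>i. (cmod (f i))\<^sup>2) summable_on UNIV"
  show "(\<lambda>i. (cmod (if inj_on g B \<and> i \<in> B then f (g i) else 0))\<^sup>2) summable_on UNIV"
  proof (cases "inj_on g B")
    case True
    have "(\<lambda>i. (cmod (f i))\<^sup>2) summable_on g ` B"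
      using f by (rule summable_on_subset) simp
    then have "(\<lambda>i. (cmod (f (g i)))\<^sup>2) summable_on B"
      by (subst (asm) summable_on_reindex[OF True]) (simp add: o_def)
    then show ?thesis
      by (subst summable_on_cong_neutral[of B]) (use True in auto)
  qed simp
qed

lemma norm_pull_vec_le: "norm (pull_vec B g x) \<le> norm x"
proof (cases "inj_on g B")
  case True
  have "(norm (pull_vec B g x))\<^sup>2 = (\<Sum>\<^sub>\<infinity>i\<in>B. (cmod (coord x (g i)))\<^sup>2)"
    unfolding norm_ell2_sq by (rule infsum_cong_neutral) (use True in \<open>auto simp: pull_vec.rep_eq\<close>)
  also have "\<dots> = (\<Sum>\<^sub>\<infinity>i\<in>g ` B. (cmod (coord x i))\<^sup>2)"
    using infsum_reindex[OF True, of "\<lambda>i. (cmod (coord x i))\<^sup>2"] by (simp add: o_def)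
  also have "\<dots> \<le> (norm x)\<^sup>2"
    unfolding norm_ell2_sq
    by (rule infsum_mono_neutral)
      (auto intro: summable_on_subset[OF coord_summable] coord_summable)
  finally show ?thesis
    by (rule power2_le_imp_le) simp
next
  case False
  then have "pull_vec B g x = 0"
    by (intro ell2_eqI) (simp add: pull_vec.rep_eq coord_simps)
  then show ?thesis
    by simp
qed

text \<open>Truncations, shifts and their adjoints are all of this form, each given by an injection
  on a set of indices.\<close>

lift_definition pull_op :: "'a set \<Rightarrow> ('a \<Rightarrow> 'a) \<Rightarrow> 'a op" is pull_vec
  by (rule bounded_linear_intro[where K = 1])
    (auto intro!: ell2_eqI simp: pull_vec.rep_eq coord_simps norm_pull_vec_le)

lemma coord_pull_op:
  "inj_on g B \<Longrightarrow> coord (pull_op B g x) i = (if i \<in> B then coord x (g i) else 0)"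
  by (simp add: pull_op.rep_eq pull_vec.rep_eq)

lemma norm_pull_op_le: "norm (pull_op B g) \<le> 1"
  by (rule norm_blinfun_bound) (simp_all add: pull_op.rep_eq norm_pull_vec_le)

abbreviation trunc :: "nat \<Rightarrow> nat op" where
  "trunc n \<equiv> pull_op {..<n} (\<lambda>i. i)"

lemma coord_trunc: "coord (trunc n x) i = (if i < n then coord x i else 0)"
  by (simp add: coord_pull_op)

lemma trunc_eq_sum: "trunc n x = (\<Sum>i<n. scaleC (coord x i) (ell2_unit i))"
  by (rule ell2_eqI) (simp add: coord_trunc coord_finite_combination)

text \<open>The convergence is only strong; convergence in norm appears after composition with a
  compact operator.\<close>

lemma trunc_tendsto: "(\<lambda>n. trunc n x) \<longlonglongrightarrow> x"
  using has_sum_imp_sums[OF ell2_unit_has_sum[of x]] by (simp add: sums_def trunc_eq_sum)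


section \<open>Adjoints\<close>

lemma bounded_opsD: "T \<in> bounded_ops \<Longrightarrow> blinfun_apply T (scaleC c x) = scaleC c (blinfun_apply T x)"
  by (simp add: bounded_ops_def)

lemma bounded_ops_add: "S \<in> bounded_ops \<Longrightarrow> T \<in> bounded_ops \<Longrightarrow> S + T \<in> bounded_ops"
  by (simp add: bounded_ops_def blinfun.add_left scaleC_add)

lemma bounded_ops_compose: "S \<in> bounded_ops \<Longrightarrow> T \<in> bounded_ops \<Longrightarrow> S o\<^sub>L T \<in> bounded_ops"
  by (simp add: bounded_ops_def)

lemma bounded_ops_scale: "T \<in> bounded_ops \<Longrightarrow> op_scale c T \<in> bounded_ops"
  by (simp add: bounded_ops_def op_scale_apply scaleC_scaleC mult.commute)

lemma op_scale_minus_one: "op_scale (-1) T = - T"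
  by (intro blinfun_eqI ell2_eqI) (simp add: op_scale_apply blinfun.minus_left coord_simps)

lemma bounded_ops_diff: "S \<in> bounded_ops \<Longrightarrow> T \<in> bounded_ops \<Longrightarrow> S - T \<in> bounded_ops"
  using bounded_ops_add[of S "op_scale (-1) T"] bounded_ops_scale[of T "-1"]
  by (simp add: op_scale_minus_one)

lemma closed_bounded_ops: "closed bounded_ops"
proof -
  have *: "bounded_ops = (\<Inter>c. \<Inter>x. {T :: 'a op. blinfun_apply T (scaleC c x) = scaleC c (blinfun_apply T x)})"
    by (auto simp: bounded_ops_def)
  show ?thesis
    unfolding *
    by (intro closed_INT ballI closed_Collect_eq continuous_intros
        bounded_linear.continuous_on[OF bounded_linear_scaleC])
qed

text \<open>The adjoint is written down by its coordinates, the conjugates of the inner products of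
  T e_i with y. The work lies in showing that they are square summable with the right bound.\<close>

lemma adjoint_exists:
  assumes T: "T \<in> bounded_ops"
  shows "\<exists>S\<in>bounded_ops. \<forall>x y. cinner (blinfun_apply T x) y = cinner x (blinfun_apply S y)"
proof -
  have ex: "\<exists>z. (\<forall>i. coord z i = cnj (cinner (T (ell2_unit i)) y)) \<and> norm z \<le> norm T * norm y" for y
  proof -
    define g where "g i = cnj (cinner (T (ell2_unit i)) y)" for i
    have "(\<Sum>i\<in>F. (cmod (g i))\<^sup>2) \<le> (norm T * norm y)\<^sup>2" if F: "finite F" for F
    proof -
      \<comment> \<open>With the wanted coordinates as coefficients, the inner product of T x and y
        equals the squared norm of x; dividing the Cauchy--Schwarz bound by the norm of x gives the
        estimate on \<open>F\<close>.\<close>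
      define x where "x = (\<Sum>i\<in>F. scaleC (g i) (ell2_unit i))"
      define r where "r = (\<Sum>i\<in>F. (cmod (g i))\<^sup>2)"
      have "(norm x)\<^sup>2 = (\<Sum>\<^sub>\<infinity>i\<in>F. (cmod (g i))\<^sup>2)"
        unfolding norm_ell2_sq x_def
        by (rule infsum_cong_neutral) (auto simp: coord_finite_combination F)
      then have nx: "(norm x)\<^sup>2 = r"
        using F by (simp add: r_def)
      have "cinner (T x) y = (\<Sum>i\<in>F. cinner (T (scaleC (g i) (ell2_unit i))) y)"
        unfolding x_def blinfun.sum_right by (rule linear_sum[OF bounded_linear.linear[OF bounded_linear_cinner]])
      also have "\<dots> = of_real r"
        by (simp add: bounded_opsD[OF T] cinner_scale_left g_def r_def mult.commute complex_norm_square[symmetric])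
      finally have "\<bar>r\<bar> \<le> norm (T x) * norm y"
        using cmod_cinner_le[of "T x" y] by (simp only: norm_of_real)
      then have "r \<le> norm (T x) * norm y"
        by simp
      also have "\<dots> \<le> norm T * norm x * norm y"
        by (intro mult_right_mono norm_blinfun) simp
      finally have "norm x * norm x \<le> norm x * (norm T * norm y)"
        using nx by (simp add: power2_eq_square mult_ac)
      then have "norm x \<le> norm T * norm y"
        by (cases "norm x = 0") (auto simp: mult_le_cancel_left)
      then show ?thesis
        unfolding r_def[symmetric] nx[symmetric] by (rule power_mono) simp
    qed
    then obtain z where "coord z = g" "norm z \<le> norm T * norm y"
      by (rule ell2_bounded_sums[rotated]) auto
    then have "\<forall>i. coord z i = cnj (cinner (T (ell2_unit i)) y)" "norm z \<le> norm T * norm y"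
      by (simp_all add: g_def)
    then show ?thesis
      by blast
  qed
  then obtain S where S: "\<And>y i. coord (S y) i = cnj (cinner (T (ell2_unit i)) y)"
    "\<And>y. norm (S y) \<le> norm y * norm T"
    by (metis mult.commute)
  have adj: "cinner (T x) y = cinner x (S y)" for x y
  proof -
    have "((\<lambda>i. cinner (T (scaleC (coord x i) (ell2_unit i))) y) has_sum cinner (T x) y) UNIV"
      using has_sum_bounded_linear[OF bounded_linear_compose[OF bounded_linear_cinner
          blinfun.bounded_linear_right] ell2_unit_has_sum, of T x y] by simp
    then have "((\<lambda>i. coord x i * cnj (coord (S y) i)) has_sum cinner (T x) y) UNIV"
      by (simp add: bounded_opsD[OF T] cinner_scale_left S)
    then show ?thesis
      unfolding cinner_def[of x] by (simp add: infsumI)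
  qed
  have "bounded_linear S"
    by (rule bounded_linear_intro[where K = "norm T"])
      (auto intro!: cinner_ext simp: adj[symmetric] cinner_add_right scaleR_scaleC cinner_scale_right
        S)
  then have "blinfun_apply (Blinfun S) = S"
    by (rule bounded_linear_Blinfun_apply)
  moreover have "S (scaleC c y) = scaleC c (S y)" for c y
    by (auto intro!: cinner_ext simp: adj[symmetric] cinner_scale_right)
  ultimately show ?thesis
    by (intro bexI[of _ "Blinfun S"]) (simp_all add: adj bounded_ops_def)
qed

lemma adjoint_opI:
  assumes S: "S \<in> bounded_ops" "\<And>x y. cinner (blinfun_apply T x) y = cinner x (blinfun_apply S y)"
  shows "adjoint_op T = S"
  unfolding adjoint_op_def
proof (rule the_equality)
  show "S \<in> bounded_ops \<and> (\<forall>x y. cinner (blinfun_apply T x) y = cinner x (blinfun_apply S y))"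
    using S by blast
  fix R assume "R \<in> bounded_ops \<and> (\<forall>x y. cinner (blinfun_apply T x) y = cinner x (blinfun_apply R y))"
  then have "cinner x (blinfun_apply R y) = cinner x (blinfun_apply S y)" for x y
    using S(2) by metis
  then show "R = S"
    by (intro blinfun_eqI cinner_ext)
qed

lemma adjoint_op_bounded: "T \<in> bounded_ops \<Longrightarrow> adjoint_op T \<in> bounded_ops"
  and cinner_adjoint: "T \<in> bounded_ops \<Longrightarrow>
    cinner (blinfun_apply T x) y = cinner x (blinfun_apply (adjoint_op T) y)"
  using adjoint_exists[of T] adjoint_opI[of _ T] by metis+

lemma cinner_adjoint': "T \<in> bounded_ops \<Longrightarrow>
    cinner (blinfun_apply (adjoint_op T) x) y = cinner x (blinfun_apply T y)"
  by (metis cinner_adjoint cnj_cinner)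

lemma adjoint_adjoint: "T \<in> bounded_ops \<Longrightarrow> adjoint_op (adjoint_op T) = T"
  by (rule adjoint_opI) (simp_all add: cinner_adjoint')

lemma adjoint_add:
  "S \<in> bounded_ops \<Longrightarrow> T \<in> bounded_ops \<Longrightarrow> adjoint_op (S + T) = adjoint_op S + adjoint_op T"
  by (rule adjoint_opI)
    (simp_all add: bounded_ops_add adjoint_op_bounded blinfun.add_left cinner_add_left
      cinner_add_right cinner_adjoint)

lemma adjoint_scale: "T \<in> bounded_ops \<Longrightarrow> adjoint_op (op_scale c T) = op_scale (cnj c) (adjoint_op T)"
  by (rule adjoint_opI)
    (simp_all add: bounded_ops_scale adjoint_op_bounded op_scale_apply cinner_scale_left
      cinner_scale_right cinner_adjoint)

lemma adjoint_compose:
  "S \<in> bounded_ops \<Longrightarrow> T \<in> bounded_ops \<Longrightarrow> adjoint_op (S o\<^sub>L T) = adjoint_op T o\<^sub>L adjoint_op S"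
  by (rule adjoint_opI) (simp_all add: bounded_ops_compose adjoint_op_bounded cinner_adjoint)

lemma adjoint_diff:
  "S \<in> bounded_ops \<Longrightarrow> T \<in> bounded_ops \<Longrightarrow> adjoint_op (S - T) = adjoint_op S - adjoint_op T"
  using adjoint_add[of S "op_scale (-1) T"] adjoint_scale[of T "-1"] bounded_ops_scale[of T "-1"]
  by (simp add: op_scale_minus_one)

text \<open>For z = T* y the squared norm of z is the inner product of T z and y; bound it by
  Cauchy--Schwarz and divide by the norm of z.\<close>

lemma norm_adjoint_le:
  assumes T: "T \<in> bounded_ops"
  shows "norm (adjoint_op T) \<le> norm T"
proof (rule norm_blinfun_bound)
  fix y
  define z where "z = blinfun_apply (adjoint_op T) y"
  have "of_real ((norm z)\<^sup>2) = cinner (blinfun_apply T z) y"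
    unfolding cinner_adjoint[OF T] by (simp add: z_def cinner_self)
  then have "(norm z)\<^sup>2 \<le> norm (blinfun_apply T z) * norm y"
    using cmod_cinner_le[of "blinfun_apply T z" y] by (metis norm_of_real abs_of_nonneg zero_le_power2)
  also have "\<dots> \<le> norm T * norm z * norm y"
    by (intro mult_right_mono norm_blinfun) simp
  finally have "norm z * norm z \<le> norm z * (norm T * norm y)"
    by (simp add: power2_eq_square mult_ac)
  then show "norm (blinfun_apply (adjoint_op T) y) \<le> norm T * norm y"
    unfolding z_def[symmetric] by (cases "norm z = 0") (auto simp: mult_le_cancel_left)
qed simp

lemma pull_op_bounded: "pull_op B g \<in> bounded_ops"
  unfolding bounded_ops_def
  by (auto intro!: ell2_eqI simp: pull_op.rep_eq pull_vec.rep_eq coord_simps)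

text \<open>Reindexing the inner product along the bijection g moves the substitution to the other
  argument, where it becomes the inverse h.\<close>

lemma adjoint_pull_op:
  assumes g: "bij_betw g B C" and h: "\<And>i. i \<in> B \<Longrightarrow> h (g i) = i"
  shows "adjoint_op (pull_op B g) = pull_op C h"
proof (rule adjoint_opI)
  have gB: "inj_on g B" and C: "C = g ` B"
    using g by (auto simp: bij_betw_def)
  have hC: "inj_on h C"
    unfolding C by (auto simp: inj_on_def h)
  fix x y
  have "cinner (pull_op B g x) y = (\<Sum>\<^sub>\<infinity>i\<in>B. coord x (g i) * cnj (coord y (h (g i))))"
    unfolding cinner_def by (rule infsum_cong_neutral) (auto simp: coord_pull_op gB h)
  also have "\<dots> = (\<Sum>\<^sub>\<infinity>i\<in>C. coord x i * cnj (coord y (h i)))"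
    by (rule infsum_reindex_bij_betw[OF g])
  also have "\<dots> = cinner x (pull_op C h y)"
    unfolding cinner_def by (rule infsum_cong_neutral) (auto simp: coord_pull_op hC)
  finally show "cinner (pull_op B g x) y = cinner x (pull_op C h y)" .
qed (rule pull_op_bounded)

lemma adjoint_trunc: "adjoint_op (trunc n) = trunc n"
  by (rule adjoint_pull_op) (auto simp: bij_betw_def)

text \<open>The isometry from the span of the first \<open>n\<close> basis vectors onto that of the next \<open>n\<close> after
  the first \<open>k\<close>, extended by \<open>0\<close>.\<close>

definition shift_op :: "nat \<Rightarrow> nat \<Rightarrow> nat op" where
  "shift_op k n = pull_op {k..<k + n} (\<lambda>i. i - k)"

lemma coord_shift_op: "coord (shift_op k n x) i = (if k \<le> i \<and> i < k + n then coord x (i - k) else 0)"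
  unfolding shift_op_def by (subst coord_pull_op) (auto simp: inj_on_def)

lemma coord_adjoint_shift_op:
  "coord (adjoint_op (shift_op k n) x) i = (if i < n then coord x (i + k) else 0)"
proof -
  have "bij_betw (\<lambda>i. i - k) {k..<k + n} {..<n}"
    by (rule bij_betw_byWitness[where f' = "\<lambda>i. i + k"]) auto
  then have "adjoint_op (shift_op k n) = pull_op {..<n} (\<lambda>i. i + k)"
    unfolding shift_op_def by (rule adjoint_pull_op) auto
  then show ?thesis
    by (simp add: coord_pull_op)
qed

lemma trunc_trunc: "trunc n o\<^sub>L trunc n = trunc n"
  by (intro blinfun_eqI ell2_eqI) (simp add: coord_trunc)

lemma shift_op_initial: "adjoint_op (shift_op k n) o\<^sub>L shift_op k n = trunc n"
  by (intro blinfun_eqI ell2_eqI) (simp add: coord_trunc coord_shift_op coord_adjoint_shift_op)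

lemma shift_op_trunc: "shift_op k n o\<^sub>L trunc n = shift_op k n"
  by (intro blinfun_eqI ell2_eqI) (auto simp: coord_trunc coord_shift_op)

text \<open>The range projection of the shift covers the indices from k to k + n - 1. Taken
  pointwise over the group, this is the source of \<open>p_add\<close>.\<close>

lemma trunc_add: "trunc (k + n) = trunc k + (shift_op k n o\<^sub>L adjoint_op (shift_op k n))"
  by (intro blinfun_eqI ell2_eqI)
    (auto simp: coord_trunc coord_shift_op coord_adjoint_shift_op blinfun.add_left coord_simps)


section \<open>Compact operators\<close>

text \<open>Each further coordinate adds the image of a disc of scalars, and a sum of two compact
  sets is compact.\<close>

lemma compact_trunc_image: "\<exists>C. compact C \<and> (\<forall>x. norm x \<le> R \<longrightarrow> trunc n x \<in> C)"
proof (induction n)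
  case 0
  then show ?case
    using trunc_eq_sum[of 0] by (intro exI[of _ "{0}"]) simp
next
  case (Suc n)
  then obtain C where C: "compact C" "\<And>x. norm x \<le> R \<Longrightarrow> trunc n x \<in> C"
    by blast
  let ?L = "(\<lambda>c. scaleC c (ell2_unit n)) ` cball 0 R"
  have "bounded_linear (\<lambda>c. scaleC c (ell2_unit n))"
    by (rule bounded_linear_intro[where K = "norm (ell2_unit n)"])
      (auto intro!: ell2_eqI simp: coord_simps norm_scaleC algebra_simps scaleR_conv_of_real)
  then have "compact ?L"
    by (rule compact_continuous_image[OF linear_continuous_on compact_cball])
  then have "compact {a + b |a b. a \<in> C \<and> b \<in> ?L}"
    using C(1) by (rule compact_sums[rotated])
  moreover have "trunc (Suc n) x \<in> {a + b |a b. a \<in> C \<and> b \<in> ?L}" if "norm x \<le> R" for x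
  proof -
    have "trunc (Suc n) x = trunc n x + scaleC (coord x n) (ell2_unit n)"
      by (simp add: trunc_eq_sum)
    moreover have "coord x n \<in> cball 0 R"
      using norm_coord_le[of x n] that by simp
    ultimately show ?thesis
      using C(2)[OF that] by blast
  qed
  ultimately show ?case
    by blast
qed

lemma norm_trunc_le: "norm (trunc n x) \<le> norm x"
  by (simp add: pull_op.rep_eq norm_pull_vec_le)

lemma compact_finite_net:
  "compact K \<Longrightarrow> 0 < e \<Longrightarrow> \<exists>k. finite k \<and> K \<subseteq> (\<Union>x\<in>k. ball x e)"
  unfolding compact_eq_totally_bounded by blast

text \<open>Truncations converge uniformly on a finite net of the image of the ball, and
  contractivity extends this to the image; conversely an operator close to its truncation has
  totally bounded image. Closure properties of compact operators thereby become statements about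
  norm limits.\<close>

lemma compact_ops_iff:
  "T \<in> compact_ops \<longleftrightarrow> T \<in> bounded_ops \<and> (\<lambda>n. trunc n o\<^sub>L T) \<longlonglongrightarrow> T"
proof (intro iffI conjI)
  assume T: "T \<in> compact_ops"
  then show "T \<in> bounded_ops"
    by (simp add: compact_ops_def)
  have K: "compact (closure (T ` cball 0 1))"
    using T by (simp add: compact_ops_def)
  show "(\<lambda>n. trunc n o\<^sub>L T) \<longlonglongrightarrow> T"
    unfolding LIMSEQ_iff
  proof (intro allI impI)
    fix e :: real assume e: "0 < e"
    obtain k where k: "finite k" "closure (T ` cball 0 1) \<subseteq> (\<Union>x\<in>k. ball x (e / 4))"
      using compact_finite_net[OF K, of "e / 4"] e by auto
    have "\<forall>\<^sub>F n in sequentially. norm (trunc n x - x) < e / 4" for x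
      using tendstoD[OF trunc_tendsto, of "e / 4" x] e by (simp add: dist_norm)
    then have "\<forall>\<^sub>F n in sequentially. \<forall>x\<in>k. norm (trunc n x - x) < e / 4"
      by (intro eventually_ball_finite[OF k(1)] ballI)
    then obtain N where N: "\<And>n x. n \<ge> N \<Longrightarrow> x \<in> k \<Longrightarrow> norm (trunc n x - x) < e / 4"
      unfolding eventually_sequentially by blast
    have "norm ((trunc n o\<^sub>L T) - T) < e" if n: "n \<ge> N" for n
    proof -
      have le: "norm (((trunc n o\<^sub>L T) - T) x) \<le> 3 / 4 * e" if "norm x \<le> 1" for x
      proof -
        have "T x \<in> closure (T ` cball 0 1)"
          using that closure_subset by fastforce
        then obtain y where y: "y \<in> k" "norm (y - T x) < e / 4"
          using k(2) by (auto simp: dist_norm)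
        have "((trunc n o\<^sub>L T) - T) x = trunc n (T x - y) + (trunc n y - y) + (y - T x)"
          by (simp add: blinfun.diff_left blinfun.diff_right algebra_simps)
        also have "norm \<dots> \<le> norm (trunc n (T x - y)) + norm (trunc n y - y) + norm (y - T x)"
          by (intro norm_triangle_le add_right_mono norm_triangle_ineq)
        also have "\<dots> \<le> e / 4 + e / 4 + e / 4"
          using y N[OF n y(1)] norm_trunc_le[of n "T x - y"] by (simp add: norm_minus_commute)
        finally show ?thesis
          by simp
      qed
      have "norm (((trunc n o\<^sub>L T) - T) x) \<le> 3 / 4 * e * norm x" for x
      proof (cases "x = 0")
        case False
        then have "norm (((trunc n o\<^sub>L T) - T) (inverse (norm x) *\<^sub>R x)) \<le> 3 / 4 * e"
          by (intro le) simp
        then show ?thesis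
          using False by (simp add: blinfun.scaleR_right field_simps)
      qed simp
      then have "norm ((trunc n o\<^sub>L T) - T) \<le> 3 / 4 * e"
        using e by (intro norm_blinfun_bound) auto
      then show ?thesis
        using e by simp
    qed
    then show "\<exists>N. \<forall>n\<ge>N. norm ((trunc n o\<^sub>L T) - T) < e"
      by blast
  qed
next
  assume T: "T \<in> bounded_ops \<and> (\<lambda>n. trunc n o\<^sub>L T) \<longlonglongrightarrow> T"
  let ?S = "T ` cball 0 1"
  have "\<exists>k. finite k \<and> closure ?S \<subseteq> (\<Union>x\<in>k. ball x e)" if e: "0 < e" for e
  proof -
    obtain n where n: "norm ((trunc n o\<^sub>L T) - T) < e / 4"
      using LIMSEQ_D[OF conjunct2[OF T], of "e / 4"] e by auto
    obtain C where C: "compact C" "\<And>x. norm x \<le> norm T \<Longrightarrow> trunc n x \<in> C"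
      using compact_trunc_image by blast
    obtain k where k: "finite k" "C \<subseteq> (\<Union>x\<in>k. ball x (e / 4))"
      using compact_finite_net[OF C(1), of "e / 4"] e by auto
    \<comment> \<open>Closed balls of half the radius let the cover pass to the closure before it is
      enlarged to open balls.\<close>
    have "?S \<subseteq> (\<Union>x\<in>k. cball x (e / 2))"
    proof safe
      fix x :: "nat ell2" assume x: "x \<in> cball 0 1"
      have b: "norm (R x) \<le> norm R" for R :: "nat op"
        using norm_blinfun[of R x] x mult_left_le[of "norm x" "norm R"] by simp
      obtain y where y: "y \<in> k" "dist y (trunc n (T x)) < e / 4"
        using C(2)[OF b] k(2) by auto
      have "dist (trunc n (T x)) (T x) < e / 4"
        using b[of "(trunc n o\<^sub>L T) - T"] n by (simp add: dist_norm blinfun.diff_left)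
      then have "dist y (T x) \<le> e / 2"
        using dist_triangle[of y "T x" "trunc n (T x)"] y(2) by simp
      with y(1) show "T x \<in> (\<Union>x\<in>k. cball x (e / 2))"
        by auto
    qed
    then have "closure ?S \<subseteq> (\<Union>x\<in>k. cball x (e / 2))"
      by (rule closure_minimal) (use k(1) in auto)
    also have "\<dots> \<subseteq> (\<Union>x\<in>k. ball x e)"
      using e by (intro UN_mono) auto
    finally show ?thesis
      using k(1) by blast
  qed
  then have "compact (closure ?S)"
    unfolding compact_eq_totally_bounded complete_eq_closed by simp
  with T show "T \<in> compact_ops"
    by (simp add: compact_ops_def)
qed

lemma compact_bounded: "T \<in> compact_ops \<Longrightarrow> T \<in> bounded_ops"
  by (simp add: compact_ops_def)

lemma trunc_compose_tendsto: "T \<in> compact_ops \<Longrightarrow> (\<lambda>n. trunc n o\<^sub>L T) \<longlonglongrightarrow> T"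
  by (simp add: compact_ops_iff)

section \<open>Operator arithmetic and closure properties of the compact operators\<close>

lemmas compose_simps =
  bounded_bilinear.add_left[OF bounded_bilinear_blinfun_compose]
  bounded_bilinear.add_right[OF bounded_bilinear_blinfun_compose]
  bounded_bilinear.diff_left[OF bounded_bilinear_blinfun_compose]
  bounded_bilinear.diff_right[OF bounded_bilinear_blinfun_compose]

lemma compose_assoc: "(R o\<^sub>L S) o\<^sub>L T = R o\<^sub>L (S o\<^sub>L T)"
  by (rule blinfun_eqI) simp

lemma op_scale_add: "op_scale c (S + T) = op_scale c S + op_scale c T"
  by (rule blinfun_eqI) (simp add: op_scale_apply blinfun.add_left scaleC_add)

lemma op_scale_compose: "op_scale c S o\<^sub>L T = op_scale c (S o\<^sub>L T)"
  by (rule blinfun_eqI) (simp add: op_scale_apply)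

lemma compose_op_scale: "S \<in> bounded_ops \<Longrightarrow> S o\<^sub>L op_scale c T = op_scale c (S o\<^sub>L T)"
  by (rule blinfun_eqI) (simp add: op_scale_apply bounded_opsD)

lemma norm_op_scale_le: "norm (op_scale c T) \<le> cmod c * norm T"
proof (rule norm_blinfun_bound)
  fix x
  show "norm (op_scale c T x) \<le> cmod c * norm T * norm x"
    using mult_left_mono[OF norm_blinfun[of T x], of "cmod c"]
    by (simp add: op_scale_apply norm_scaleC mult.assoc)
qed simp

lemma bounded_linear_op_scale: "bounded_linear (op_scale c)"
proof (rule bounded_linear_intro[where K = "cmod c"])
  show "op_scale c (S + T) = op_scale c S + op_scale c T" for S T :: "'a op"
    by (rule op_scale_add)
  show "op_scale c (r *\<^sub>R T) = r *\<^sub>R op_scale c T" for r and T :: "'a op"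
    by (intro blinfun_eqI ell2_eqI) (simp add: op_scale_apply coord_simps blinfun.scaleR_left)
  show "norm (op_scale c T) \<le> norm T * cmod c" for T :: "'a op"
    using norm_op_scale_le[of c T] by (simp add: mult.commute)
qed

lemma compact_add: "(S :: nat op) \<in> compact_ops \<Longrightarrow> T \<in> compact_ops \<Longrightarrow> S + T \<in> compact_ops"
  unfolding compact_ops_iff by (auto intro: bounded_ops_add tendsto_add simp: compose_simps)

lemma compact_scale: "(T :: nat op) \<in> compact_ops \<Longrightarrow> op_scale c T \<in> compact_ops"
  unfolding compact_ops_iff
  by (auto intro: bounded_ops_scale bounded_linear.tendsto[OF bounded_linear_op_scale]
      simp: compose_op_scale pull_op_bounded)

lemma compact_compose: "(S :: nat op) \<in> compact_ops \<Longrightarrow> T \<in> bounded_ops \<Longrightarrow> S o\<^sub>L T \<in> compact_ops"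
  unfolding compact_ops_iff
  by (auto intro!: bounded_ops_compose bounded_linear.tendsto[OF
        bounded_bilinear.bounded_linear_left[OF bounded_bilinear_blinfun_compose]]
      simp: compose_assoc[symmetric])

lemma compact_zero: "(0 :: nat op) \<in> compact_ops"
  unfolding compact_ops_iff
  by (auto simp: bounded_ops_def intro!: ell2_eqI) (simp add: coord_simps)

text \<open>The composition is determined by the finitely many vectors S e_i with i < k, and strong
  convergence of truncations on these gives the norm bound \<open>b\<close>.\<close>

lemma compact_compose_trunc:
  assumes S: "S \<in> bounded_ops"
  shows "S o\<^sub>L trunc k \<in> compact_ops"
proof -
  let ?R = "S o\<^sub>L trunc k"
  define b where "b n = (\<Sum>i<k. norm (trunc n (S (ell2_unit i)) - S (ell2_unit i)))" for n
  have "b \<longlonglongrightarrow> (\<Sum>i<k. norm (S (ell2_unit i) - S (ell2_unit i)))"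
    unfolding b_def by (intro tendsto_intros trunc_tendsto)
  then have b0: "b \<longlonglongrightarrow> 0"
    by simp
  have "norm ((trunc n o\<^sub>L ?R) - ?R) \<le> b n" for n
  proof (rule norm_blinfun_bound)
    show "0 \<le> b n"
      by (simp add: b_def sum_nonneg)
    fix x
    have "((trunc n o\<^sub>L ?R) - ?R) x =
        (\<Sum>i<k. scaleC (coord x i) (trunc n (S (ell2_unit i)) - S (ell2_unit i)))"
      by (simp add: blinfun.diff_left trunc_eq_sum[of k] blinfun.sum_right bounded_opsD[OF S]
          bounded_opsD[OF pull_op_bounded] linear_diff[OF bounded_linear.linear[OF bounded_linear_scaleC]]
          sum_subtractf)
    also have "norm \<dots> \<le> (\<Sum>i<k. norm x * norm (trunc n (S (ell2_unit i)) - S (ell2_unit i)))"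
      by (intro sum_norm_le) (simp add: norm_scaleC mult_right_mono norm_coord_le)
    finally show "norm (((trunc n o\<^sub>L ?R) - ?R) x) \<le> b n * norm x"
      by (simp add: b_def sum_distrib_left mult.commute)
  qed
  then have "(\<lambda>n. (trunc n o\<^sub>L ?R) - ?R) \<longlonglongrightarrow> 0"
    by (intro Lim_null_comparison[OF _ b0]) auto
  then have "(\<lambda>n. trunc n o\<^sub>L ?R) \<longlonglongrightarrow> ?R"
    by (rule LIM_zero_cancel)
  then show ?thesis
    unfolding compact_ops_iff using bounded_ops_compose[OF S pull_op_bounded] by blast
qed

text \<open>Truncations are contractions, so an approximating compact operator transfers its
  convergence to the limit by a three-term estimate.\<close>

lemma closed_compact_ops: "closed (compact_ops :: nat op set)"
proof -
  have "T \<in> compact_ops" if T: "T \<in> closure compact_ops" for T :: "nat op"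
    unfolding compact_ops_iff
  proof
    show "T \<in> bounded_ops"
      using T closure_minimal[of compact_ops bounded_ops] closed_bounded_ops compact_bounded by blast
    show "(\<lambda>n. trunc n o\<^sub>L T) \<longlonglongrightarrow> T"
      unfolding LIMSEQ_iff
    proof (intro allI impI)
      fix e :: real assume e: "0 < e"
      obtain S where S: "S \<in> compact_ops" "norm (S - T) < e / 4"
        using T[unfolded closure_approachable, rule_format, of "e / 4"] e by (auto simp: dist_norm)
      obtain N where N: "\<And>n. n \<ge> N \<Longrightarrow> norm ((trunc n o\<^sub>L S) - S) < e / 4"
        using LIMSEQ_D[OF trunc_compose_tendsto[OF S(1)], of "e / 4"] e by auto
      have "norm ((trunc n o\<^sub>L T) - T) < e" if "n \<ge> N" for n
      proof -
        have "norm (trunc n o\<^sub>L (T - S)) \<le> norm (trunc n) * norm (T - S)"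
          by (rule norm_blinfun_compose)
        also have "\<dots> \<le> 1 * (e / 4)"
          using S(2) by (intro mult_mono norm_pull_op_le) (auto simp: norm_minus_commute)
        finally have "norm (trunc n o\<^sub>L (T - S)) \<le> e / 4"
          by simp
        moreover have "(trunc n o\<^sub>L T) - T = (trunc n o\<^sub>L (T - S)) + ((trunc n o\<^sub>L S) - S) + (S - T)"
          by (simp add: compose_simps)
        then have "norm ((trunc n o\<^sub>L T) - T) \<le>
            norm (trunc n o\<^sub>L (T - S)) + norm ((trunc n o\<^sub>L S) - S) + norm (S - T)"
          by (metis norm_triangle_le norm_triangle_ineq add_right_mono)
        ultimately show ?thesis
          using N[OF that] S(2) e by linarith
      qed
      then show "\<exists>N. \<forall>n\<ge>N. norm ((trunc n o\<^sub>L T) - T) < e"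
        by blast
    qed
  qed
  then show ?thesis
    by (metis closure_subset closure_eq subsetI subset_antisym)
qed

text \<open>Adjoints of truncations of T are T* composed with a truncation on the right. They are
  compact by \<open>compact_compose_trunc\<close> and converge to T* in norm.\<close>

lemma compact_adjoint:
  assumes T: "(T :: nat op) \<in> compact_ops"
  shows "adjoint_op T \<in> compact_ops"
proof -
  note b = compact_bounded[OF T]
  have "(\<lambda>n. adjoint_op T o\<^sub>L trunc n) \<longlonglongrightarrow> adjoint_op T"
  proof (rule LIM_zero_cancel, rule Lim_null_comparison)
    show "(\<lambda>n. norm ((trunc n o\<^sub>L T) - T)) \<longlonglongrightarrow> 0"
      using trunc_compose_tendsto[OF T] by (simp add: LIM_zero tendsto_norm_zero)
    have "(adjoint_op T o\<^sub>L trunc n) - adjoint_op T = adjoint_op ((trunc n o\<^sub>L T) - T)" for n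
      by (simp add: adjoint_diff adjoint_compose bounded_ops_compose pull_op_bounded b adjoint_trunc)
    then show "\<forall>\<^sub>F n in sequentially. norm ((adjoint_op T o\<^sub>L trunc n) - adjoint_op T) \<le> norm ((trunc n o\<^sub>L T) - T)"
      by (simp add: norm_adjoint_le bounded_ops_diff bounded_ops_compose pull_op_bounded b)
  qed
  then show ?thesis
    by (rule closed_sequentially[OF closed_compact_ops compact_compose_trunc[OF adjoint_op_bounded[OF b]]])
qed

lemma trunc_compact: "trunc n \<in> compact_ops"
  using compact_compose_trunc[OF pull_op_bounded, of "{..<n}" "\<lambda>i. i" n] by (simp add: trunc_trunc)

lemma shift_op_bounded: "shift_op k n \<in> bounded_ops"
  unfolding shift_op_def by (rule pull_op_bounded)

lemma shift_op_compact: "shift_op k n \<in> compact_ops"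
  using compact_compose_trunc[OF shift_op_bounded, of k n n] by (simp add: shift_op_trunc)

lemma norm_shift_op_le: "norm (shift_op k n) \<le> 1"
  unfolding shift_op_def by (rule norm_pull_op_le)


section \<open>Quasi-inverses\<close>

text \<open>The Neumann series u + u^2 + ... stays in any closed set containing 0 and closed under
  sums and products; here these are the compact operators and the Roe algebra. The explicit norm
  bound makes quasi-inverses uniform over the group.\<close>

lemma quasi_inverse:
  fixes u :: "'b::banach \<Rightarrow>\<^sub>L 'b"
  assumes S: "closed S" "0 \<in> S" "\<And>x y. x \<in> S \<Longrightarrow> y \<in> S \<Longrightarrow> x + y \<in> S"
    "\<And>x y. x \<in> S \<Longrightarrow> y \<in> S \<Longrightarrow> x o\<^sub>L y \<in> S"
    and u: "u \<in> S" "norm u \<le> c" "c < 1"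
  obtains v where "v \<in> S" "v = u + (v o\<^sub>L u)" "norm v \<le> c / (1 - c)"
proof -
  have c: "0 \<le> c"
    using u(2) norm_ge_zero order_trans by blast
  \<comment> \<open>The exponent is off by one: \<open>w n\<close> is the power n + 1 of u, so no
    identity operator is involved.\<close>
  define w where "w n = ((\<lambda>x. x o\<^sub>L u) ^^ n) u" for n
  have wS: "w n \<in> S" for n
    by (induction n) (auto simp: w_def S u)
  have wn: "norm (w n) \<le> c * c ^ n" for n
  proof (induction n)
    case (Suc n)
    have "norm (w (Suc n)) \<le> norm (w n) * norm u"
      unfolding w_def by (simp add: norm_blinfun_compose)
    also have "\<dots> \<le> (c * c ^ n) * c"
      using Suc u c by (intro mult_mono) auto
    finally show ?case
      by (simp add: mult_ac)
  qed (use u in \<open>simp add: w_def\<close>)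
  have geo: "(\<lambda>n. c * c ^ n) sums (c * (1 / (1 - c)))"
    using u c by (intro sums_mult geometric_sums) simp
  then have sn: "summable (\<lambda>n. norm (w n))"
    by (intro summable_comparison_test'[OF sums_summable[OF geo], of 0]) (simp add: wn)
  then have s: "summable w"
    by (rule summable_norm_cancel)
  let ?v = "suminf w"
  show ?thesis
  proof
    have "(\<Sum>i<n. w i) \<in> S" for n
      by (induction n) (auto simp: S wS)
    then show "?v \<in> S"
      by (rule closed_sequentially[OF S(1) _ summable_LIMSEQ[OF s]])
    have "?v = w 0 + (\<Sum>n. w (Suc n))"
      using suminf_split_head[OF s] by simp
    also have "(\<lambda>n. w (Suc n)) = (\<lambda>n. w n o\<^sub>L u)"
      by (simp add: w_def)
    also have "(\<Sum>n. w n o\<^sub>L u) = ?v o\<^sub>L u"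
      using bounded_linear.suminf[OF bounded_bilinear.bounded_linear_left[OF bounded_bilinear_blinfun_compose] s, of u]
      by simp
    also have "w 0 = u"
      by (simp add: w_def)
    finally show "?v = u + (?v o\<^sub>L u)" .
    have "norm ?v \<le> (\<Sum>n. norm (w n))"
      by (rule summable_norm[OF sn])
    also have "\<dots> \<le> (\<Sum>n. c * c ^ n)"
      by (rule suminf_le[OF wn sn sums_summable[OF geo]])
    finally show "norm ?v \<le> c / (1 - c)"
      using sums_unique[OF geo] by simp
  qed
qed

text \<open>Composing the equation for v with e on the right replaces e - x by e - x e; the terms v
  e then cancel.\<close>

lemma idempotent_factorization:
  assumes "e o\<^sub>L e = e" "v = (e - x) + (v o\<^sub>L (e - x))"
  shows "e = (x o\<^sub>L e) + (v o\<^sub>L (x o\<^sub>L e))"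
proof -
  have "v o\<^sub>L e = ((e - x) + (v o\<^sub>L (e - x))) o\<^sub>L e"
    using assms(2) by simp
  also have "\<dots> = e - (x o\<^sub>L e) + ((v o\<^sub>L e) - (v o\<^sub>L (x o\<^sub>L e)))"
    by (simp add: compose_simps compose_assoc assms(1))
  finally show ?thesis
    by (simp add: algebra_simps)
qed


section \<open>The algebra \<open>\<ell>\<^sup>\<infinity>(G, \<K>)\<close>\<close>

lemma linf_carrier_iff:
  "f \<in> carrier linf_compact \<longleftrightarrow> (\<forall>s. f s \<in> compact_ops) \<and> (\<exists>B. \<forall>s. norm (f s) \<le> B)"
  by (auto simp: linf_compact_def bounded_iff)

lemma linf_compact_ops: "f \<in> carrier linf_compact \<Longrightarrow> f s \<in> compact_ops"
  by (simp add: linf_carrier_iff)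

lemma linf_bounded_ops: "f \<in> carrier linf_compact \<Longrightarrow> f s \<in> bounded_ops"
  by (simp add: linf_compact_ops compact_bounded)

lemma linf_bounded_range: "f \<in> carrier linf_compact \<Longrightarrow> bounded (range f)"
  by (simp add: linf_compact_def)

lemma linf_simps:
  "add linf_compact f g = (\<lambda>s. f s + g s)"
  "scale linf_compact c f = (\<lambda>s. op_scale c (f s))"
  "mult linf_compact f g = (\<lambda>s. f s o\<^sub>L g s)"
  "star linf_compact f = (\<lambda>s. adjoint_op (f s))"
  "cnorm linf_compact f = (SUP s. norm (f s))"
  by (simp_all add: linf_compact_def)

lemma linf_add_closed:
  assumes "f \<in> carrier linf_compact" "g \<in> carrier linf_compact"
  shows "(\<lambda>s. f s + g s) \<in> carrier linf_compact"
proof -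
  obtain B C where "\<And>s. norm (f s) \<le> B" "\<And>s. norm (g s) \<le> C"
    using assms unfolding linf_carrier_iff by blast
  then have "norm (f s + g s) \<le> B + C" for s
    by (meson norm_triangle_mono)
  then show ?thesis
    using assms unfolding linf_carrier_iff by (blast intro: compact_add)
qed

lemma linf_scale_closed:
  assumes "f \<in> carrier linf_compact"
  shows "(\<lambda>s. op_scale c (f s)) \<in> carrier linf_compact"
proof -
  obtain B where "\<And>s. norm (f s) \<le> B"
    using assms unfolding linf_carrier_iff by blast
  then have "norm (op_scale c (f s)) \<le> cmod c * B" for s
    by (meson norm_op_scale_le mult_left_mono norm_ge_zero order_trans)
  then show ?thesis
    using assms unfolding linf_carrier_iff by (blast intro: compact_scale)
qed

lemma linf_mult_closed:
  assumes "f \<in> carrier linf_compact" "g \<in> carrier linf_compact"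
  shows "(\<lambda>s. f s o\<^sub>L g s) \<in> carrier linf_compact"
proof -
  obtain B C where BC: "\<And>s. norm (f s) \<le> B" "\<And>s. norm (g s) \<le> C"
    using assms unfolding linf_carrier_iff by blast
  have "norm (f s o\<^sub>L g s) \<le> B * C" for s
    using norm_blinfun_compose[of "f s" "g s"]
      mult_mono'[OF BC(1)[of s] BC(2)[of s] norm_ge_zero norm_ge_zero] by linarith
  then show ?thesis
    using assms unfolding linf_carrier_iff by (blast intro: compact_compose compact_bounded)
qed

lemma linf_star_closed:
  assumes "f \<in> carrier linf_compact"
  shows "(\<lambda>s. adjoint_op (f s)) \<in> carrier linf_compact"
proof -
  obtain B where "\<And>s. norm (f s) \<le> B"
    using assms unfolding linf_carrier_iff by blast
  then have "norm (adjoint_op (f s)) \<le> B" for s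
    by (meson norm_adjoint_le linf_bounded_ops[OF assms] order_trans)
  then show ?thesis
    using assms unfolding linf_carrier_iff by (blast intro: compact_adjoint)
qed

lemma linf_trunc: "(\<lambda>s. trunc (m s)) \<in> carrier linf_compact"
  unfolding linf_carrier_iff using trunc_compact norm_pull_op_le by blast

lemma linf_shift: "(\<lambda>s. shift_op (m s) (n s)) \<in> carrier linf_compact"
  unfolding linf_carrier_iff using shift_op_compact norm_shift_op_le by blast

lemma linf_translation: "f \<in> carrier linf_compact \<Longrightarrow> left_translation t f \<in> carrier linf_compact"
  unfolding linf_carrier_iff left_translation_def by blast

text \<open>Quasi-inverses are taken at each point of the group. The supremum c is a common bound
  below 1, so their norms are bounded uniformly by c / (1 - c).\<close>

lemma linf_perturbed_idempotent:
  assumes e: "e \<in> carrier linf_compact" "\<And>s. e s o\<^sub>L e s = e s" and x: "x \<in> carrier linf_compact"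
    and less: "(SUP s. norm (e s - x s)) < 1"
  shows "\<exists>v\<in>carrier linf_compact. \<forall>s. e s = (x s o\<^sub>L e s) + (v s o\<^sub>L (x s o\<^sub>L e s))"
proof -
  define c where "c = (SUP s. norm (e s - x s))"
  have diff: "(\<lambda>s. e s - x s) \<in> carrier linf_compact"
    using linf_add_closed[OF e(1) linf_scale_closed[OF x, of "-1"]] by (simp add: op_scale_minus_one)
  have "bdd_above (range (\<lambda>s. norm (e s - x s)))"
    using diff unfolding linf_carrier_iff by (auto intro: bdd_aboveI)
  then have le: "norm (e s - x s) \<le> c" for s
    unfolding c_def by (rule cSUP_upper[OF UNIV_I])
  have c: "c < 1"
    using less by (simp add: c_def)
  have "\<exists>v. v \<in> compact_ops \<and> v = (e s - x s) + (v o\<^sub>L (e s - x s)) \<and> norm v \<le> c / (1 - c)" for s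
    by (rule quasi_inverse[OF closed_compact_ops compact_zero compact_add
          compact_compose[OF _ compact_bounded] linf_compact_ops[OF diff] le c]) blast+
  then obtain v where v: "\<And>s. v s \<in> compact_ops" "\<And>s. v s = (e s - x s) + (v s o\<^sub>L (e s - x s))"
    "\<And>s. norm (v s) \<le> c / (1 - c)"
    by metis
  show ?thesis
  proof (intro bexI[of _ v] allI)
    show "v \<in> carrier linf_compact"
      unfolding linf_carrier_iff using v by blast
    show "e s = (x s o\<^sub>L e s) + (v s o\<^sub>L (x s o\<^sub>L e s))" for s
      using e(2) v(2) by (rule idempotent_factorization)
  qed
qed

text \<open>The required rank depends on the point s, which is why the projections are indexed by
  functions on the group. Monotonicity in the rank later allows two such functions to be replaced by
  their maximum.\<close>

lemma linf_approx:
  assumes a: "a \<in> carrier linf_compact" and \<epsilon>: "0 < \<epsilon>"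
  shows "\<exists>m. \<forall>s. \<forall>n\<ge>m s. norm (a s - (trunc n o\<^sub>L a s)) < \<epsilon>"
proof -
  have "\<exists>m. \<forall>n\<ge>m. norm (a s - (trunc n o\<^sub>L a s)) < \<epsilon>" for s
    using LIMSEQ_D[OF trunc_compose_tendsto[OF linf_compact_ops[OF a]] \<epsilon>]
    by (simp add: norm_minus_commute)
  then show ?thesis
    by metis
qed

lemma rank_algebra_linf: "rank_algebra linf_compact (\<lambda>(m :: 'g \<Rightarrow> nat) s. trunc (m s))"
proof (unfold_locales, unfold linf_simps)
  fix f g h :: "'g \<Rightarrow> nat op" and c
  assume f: "f \<in> carrier linf_compact"
  note fb = linf_bounded_ops[OF f]
  show "(\<lambda>s. op_scale c (f s)) \<in> carrier linf_compact" "(\<lambda>s. adjoint_op (f s)) \<in> carrier linf_compact"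
    using f by (rule linf_scale_closed linf_star_closed)+
  show "(\<lambda>s. adjoint_op (op_scale c (f s))) = (\<lambda>s. op_scale (cnj c) (adjoint_op (f s)))"
    "(\<lambda>s. adjoint_op (adjoint_op (f s))) = f"
    by (simp_all add: adjoint_scale adjoint_adjoint fb)
  show "\<exists>m. (SUP s. norm (f s + op_scale (- 1) (trunc (m s) o\<^sub>L f s))) < \<epsilon>" if \<epsilon>: "0 < \<epsilon>" for \<epsilon>
  proof -
    \<comment> \<open>Half of \<epsilon> is taken because a supremum of strictly smaller values may
      attain the bound.\<close>
    obtain m where "\<And>s. norm (f s - (trunc (m s) o\<^sub>L f s)) < \<epsilon> / 2"
      using linf_approx[OF f half_gt_zero[OF \<epsilon>]] by blast
    then have "(SUP s. norm (f s + op_scale (- 1) (trunc (m s) o\<^sub>L f s))) \<le> \<epsilon> / 2"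
      by (intro cSUP_least) (auto simp: op_scale_minus_one intro: less_imp_le)
    with \<epsilon> show ?thesis
      by (intro exI[of _ m]) simp
  qed
  assume g: "g \<in> carrier linf_compact"
  note gb = linf_bounded_ops[OF g]
  show "(\<lambda>s. f s + g s) \<in> carrier linf_compact" "(\<lambda>s. f s o\<^sub>L g s) \<in> carrier linf_compact"
    using f g by (rule linf_add_closed linf_mult_closed)+
  show "(\<lambda>s. op_scale c (f s) o\<^sub>L g s) = (\<lambda>s. op_scale c (f s o\<^sub>L g s))"
    "(\<lambda>s. f s o\<^sub>L op_scale c (g s)) = (\<lambda>s. op_scale c (f s o\<^sub>L g s))"
    "(\<lambda>s. op_scale c (f s + g s)) = (\<lambda>s. op_scale c (f s) + op_scale c (g s))"
    "(\<lambda>s. adjoint_op (f s + g s)) = (\<lambda>s. adjoint_op (f s) + adjoint_op (g s))"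
    "(\<lambda>s. adjoint_op (f s o\<^sub>L g s)) = (\<lambda>s. adjoint_op (g s) o\<^sub>L adjoint_op (f s))"
    by (simp_all add: op_scale_compose compose_op_scale op_scale_add adjoint_add adjoint_compose fb gb)
  show "\<exists>v\<in>carrier linf_compact. f = (\<lambda>s. (g s o\<^sub>L f s) + (v s o\<^sub>L (g s o\<^sub>L f s)))"
    if "(\<lambda>s. f s o\<^sub>L f s) = f" "(SUP s. norm (f s + op_scale (- 1) (g s))) < 1"
    using linf_perturbed_idempotent[OF f _ g] that by (simp add: fun_eq_iff op_scale_minus_one)
  assume h: "h \<in> carrier linf_compact"
  show "(\<lambda>s. (f s o\<^sub>L g s) o\<^sub>L h s) = (\<lambda>s. f s o\<^sub>L (g s o\<^sub>L h s))"
    "(\<lambda>s. (f s + g s) o\<^sub>L h s) = (\<lambda>s. (f s o\<^sub>L h s) + (g s o\<^sub>L h s))"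
    "(\<lambda>s. f s o\<^sub>L (g s + h s)) = (\<lambda>s. (f s o\<^sub>L g s) + (f s o\<^sub>L h s))"
    by (simp_all add: compose_assoc compose_simps)
next
  fix m n :: "'g \<Rightarrow> nat"
  show "(\<lambda>s. trunc (m s)) \<in> carrier linf_compact"
    by (rule linf_trunc)
  show "(\<lambda>s. trunc (m s) o\<^sub>L trunc (m s)) = (\<lambda>s. trunc (m s))"
    "(\<lambda>s. adjoint_op (trunc (m s))) = (\<lambda>s. trunc (m s))"
    by (simp_all add: trunc_trunc adjoint_trunc)
  show "\<exists>v\<in>carrier linf_compact. (\<lambda>s. adjoint_op (v s) o\<^sub>L v s) = (\<lambda>s. trunc (n s)) \<and>
      (\<lambda>s. v s o\<^sub>L trunc (n s)) = v \<and>
      (\<lambda>s. trunc (m s + n s)) = (\<lambda>s. trunc (m s) + (v s o\<^sub>L adjoint_op (v s)))"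
    by (intro bexI[of _ "\<lambda>s. shift_op (m s) (n s)"] linf_shift)
      (simp add: shift_op_initial shift_op_trunc trunc_add)
qed

text \<open>Left translation by t - s moves s to (t - s) + s = t; the order matters, as the group
  need not be commutative. The function h will be \<open>trunc\<close>.\<close>

lemma translation_indicator:
  fixes s t :: "'g::group_add"
  shows "left_translation (t - s) (\<lambda>r. h (indicator {s} r)) = (\<lambda>r. h (indicator {t} r))"
proof -
  have "- (t - s) + r = s \<longleftrightarrow> r = t" for r
  proof -
    have "- (t - s) + r = s \<longleftrightarrow> r = (t - s) + s"
      by (metis add.assoc add.left_inverse add.left_neutral add.right_inverse)
    then show ?thesis
      by simp
  qed
  then show ?thesis
    by (simp add: left_translation_def indicator_def fun_eq_iff)
qed

lemma no_invariant_trace_linf: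
  assumes "countable (UNIV :: 'g::group_add set)" "infinite (UNIV :: 'g set)"
    and tr: "densely_defined_lsc_trace linf_compact \<tau>"
    and inv: "invariant_trace linf_compact (left_translation :: 'g \<Rightarrow> _) \<tau>"
  shows "\<not> nonzero_trace linf_compact \<tau>"
proof -
  interpret rank_algebra linf_compact "\<lambda>(m :: 'g \<Rightarrow> nat) s. trunc (m s)"
    by (rule rank_algebra_linf)
  show ?thesis
  proof (rule no_trace[OF assms(1-3)])
    fix s t :: 'g
    have "\<tau> (left_translation (t - s) (\<lambda>r. trunc (indicator {s} r))) = \<tau> (\<lambda>r. trunc (indicator {s} r))"
      using inv p_pideal unfolding invariant_trace_def Ped_eq by blast
    then show "\<tau> (\<lambda>r. trunc (indicator {s} r)) = \<tau> (\<lambda>r. trunc (indicator {t} r))"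
      unfolding translation_indicator[of t s trunc] by simp
  qed
qed


section \<open>Block diagonal operators and translations\<close>

lemma fiber_ext: "(\<And>t. fiber \<xi> t = fiber \<eta> t) \<Longrightarrow> \<xi> = \<eta>"
  by (rule ell2_eqI) (metis fiber.rep_eq surj_pair)

lemma fiber_add: "fiber (\<xi> + \<eta>) t = fiber \<xi> t + fiber \<eta> t"
  and fiber_diff: "fiber (\<xi> - \<eta>) t = fiber \<xi> t - fiber \<eta> t"
  and fiber_scaleC: "fiber (scaleC c \<xi>) t = scaleC c (fiber \<xi> t)"
  by (auto intro!: ell2_eqI simp: coord_simps)

lemma fiber_block_diag: "bounded (range T) \<Longrightarrow> fiber (block_diag T \<xi>) t = T t (fiber \<xi> t)"
  by (rule ell2_eqI) (simp add: fiber.rep_eq coord_block_diag)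

lemma norm_block_diag_le:
  assumes "\<And>t. norm (T t) \<le> B"
  shows "norm (block_diag T) \<le> B"
proof (rule norm_blinfun_bound)
  have bdd: "bounded (range T)"
    using assms by (auto simp: bounded_iff)
  show B: "0 \<le> B"
    using assms norm_ge_zero order_trans by blast
  fix \<xi>
  have "coord (block_diag T \<xi>) = (\<lambda>(t, x). coord (T t (fiber \<xi> t)) x)"
    by (auto simp: coord_block_diag[OF bdd])
  then have "(norm (block_diag T \<xi>))\<^sup>2 \<le> (B * norm \<xi>)\<^sup>2"
    unfolding norm_ell2_sq[of "block_diag T \<xi>"] using block_diag_aux(2)[of T B \<xi>, OF assms] by simp
  then show "norm (block_diag T \<xi>) \<le> B * norm \<xi>"
    by (rule power2_le_imp_le) (simp add: B)
qed

lemma block_diag_bounded: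
  "bounded (range T) \<Longrightarrow> (\<And>t. T t \<in> bounded_ops) \<Longrightarrow> block_diag T \<in> bounded_ops"
  unfolding bounded_ops_def by (auto intro!: fiber_ext simp: fiber_block_diag fiber_scaleC)

text \<open>Fubini for the summable double family; it reduces adjoints of block diagonal operators
  and translations to computations in the fibers.\<close>

lemma cinner_fibers: "cinner \<xi> \<eta> = (\<Sum>\<^sub>\<infinity>t. cinner (fiber \<xi> t) (fiber \<eta> t))"
proof -
  have "(\<lambda>p. coord \<xi> p * cnj (coord \<eta> p)) summable_on UNIV \<times> UNIV"
    using cinner_summable[of \<xi> \<eta>] by simp
  from infsum_Sigma_banach[OF this] show ?thesis
    by (simp add: cinner_def fiber.rep_eq)
qed

lemma adjoint_block_diag:
  assumes T: "bounded (range T)" "\<And>t. T t \<in> bounded_ops"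
  shows "adjoint_op (block_diag T) = block_diag (\<lambda>t. adjoint_op (T t))"
proof (rule adjoint_opI)
  obtain B where "\<And>t. norm (T t) \<le> B"
    using T(1) by (auto simp: bounded_iff)
  then have "norm (adjoint_op (T t)) \<le> B" for t
    using norm_adjoint_le[OF T(2)] order_trans by blast
  then have bdd: "bounded (range (\<lambda>t. adjoint_op (T t)))"
    by (auto simp: bounded_iff)
  show "block_diag (\<lambda>t. adjoint_op (T t)) \<in> bounded_ops"
    by (intro block_diag_bounded bdd adjoint_op_bounded T)
  show "cinner (block_diag T \<xi>) \<eta> = cinner \<xi> (block_diag (\<lambda>t. adjoint_op (T t)) \<eta>)" for \<xi> \<eta>
    by (simp add: cinner_fibers[of "block_diag T \<xi>"] cinner_fibers[of \<xi>] fiber_block_diag T bdd cinner_adjoint)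
qed

lemma fiber_translation: "fiber (translation s \<xi>) t = fiber \<xi> (- s + t)"
  by (rule ell2_eqI) (simp add: fiber.rep_eq coord_translation)

lemma translation_bounded: "translation s \<in> bounded_ops"
  unfolding bounded_ops_def by (auto intro!: fiber_ext simp: fiber_translation fiber_scaleC)

lemma translation_zero: "translation 0 = id_blinfun"
  by (auto intro!: blinfun_eqI fiber_ext simp: fiber_translation)

lemma translation_compose: "translation s o\<^sub>L translation t = translation (s + t)"
  by (auto intro!: blinfun_eqI fiber_ext simp: fiber_translation minus_add add.assoc simp del: add_uminus_conv_diff)

lemma bij_add_left: "bij ((+) (s :: 'g::group_add))"
  by (rule bij_betw_byWitness[where f' = "(+) (- s)"]) (auto simp: add.assoc[symmetric])

lemma adjoint_translation: "adjoint_op (translation s) = translation (- s)"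
proof (rule adjoint_opI)
  fix \<xi> \<eta> :: "('a \<times> 'b) ell2"
  \<comment> \<open>Writing t as s + (- s + t) makes the summand a function of - s + t alone, ready
    for the change of variable.\<close>
  have "cinner (translation s \<xi>) \<eta> = (\<Sum>\<^sub>\<infinity>t. cinner (fiber \<xi> (- s + t)) (fiber \<eta> (s + (- s + t))))"
    by (simp add: cinner_fibers[of "translation s \<xi>"] fiber_translation add.assoc[symmetric])
  also have "\<dots> = (\<Sum>\<^sub>\<infinity>t. cinner (fiber \<xi> t) (fiber \<eta> (s + t)))"
    by (rule infsum_reindex_bij_betw[OF bij_add_left])
  also have "\<dots> = cinner \<xi> (translation (- s) \<eta>)"
    by (simp add: cinner_fibers[of \<xi>] fiber_translation)
  finally show "cinner (translation s \<xi>) \<eta> = cinner \<xi> (translation (- s) \<eta>)" .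
qed (rule translation_bounded)

lemma norm_translation_le: "norm (translation s) \<le> 1"
proof (rule norm_blinfun_bound)
  fix \<xi> :: "('a \<times> 'b) ell2"
  have "of_real ((norm (translation s \<xi>))\<^sup>2) = cinner \<xi> ((translation (- s) o\<^sub>L translation s) \<xi>)"
    using cinner_adjoint[OF translation_bounded[of s], of \<xi> "translation s \<xi>"]
    by (simp add: cinner_self adjoint_translation)
  also have "\<dots> = of_real ((norm \<xi>)\<^sup>2)"
    by (simp add: translation_compose translation_zero cinner_self)
  finally have "(norm (translation s \<xi>))\<^sup>2 = (norm \<xi>)\<^sup>2"
    by (simp only: of_real_eq_iff)
  then show "norm (translation s \<xi>) \<le> 1 * norm \<xi>"
    by (simp add: power2_eq_iff_nonneg)
qed simp


section \<open>The Roe algebra\<close>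

definition rep :: "('g::group_add \<Rightarrow> nat op) \<Rightarrow> ('g \<times> 'g \<times> nat) op" where
  "rep = regular_rep left_translation block_diag"

lemma bounded_translates: "bounded (range a) \<Longrightarrow> bounded (range (left_translation t a))"
  by (rule bounded_subset) (auto simp: left_translation_def)

lemma rep_aux:
  assumes "bounded (range a)"
  shows "bounded (range (\<lambda>t. block_diag (left_translation (- t) a)))"
proof -
  obtain B where "\<And>s. norm (a s) \<le> B"
    using assms by (auto simp: bounded_iff)
  then have "norm (block_diag (left_translation (- t) a)) \<le> B" for t
    by (intro norm_block_diag_le) (simp add: left_translation_def)
  then show ?thesis
    by (auto simp: bounded_iff)
qed

text \<open>Acting by - t turns a into s \<mapsto> a (t + s). With \<open>fiber_fiber_ext\<close>,
  operator identities for \<open>rep\<close> reduce to pointwise identities for a.\<close>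

lemma fiber_rep: "bounded (range a) \<Longrightarrow> fiber (fiber (rep a \<xi>) t) s = a (t + s) (fiber (fiber \<xi> t) s)"
  unfolding rep_def regular_rep_def
  by (simp add: fiber_block_diag rep_aux bounded_translates) (simp add: left_translation_def)

lemma fiber_fiber_ext: "(\<And>t s. fiber (fiber \<xi> t) s = fiber (fiber \<eta> t) s) \<Longrightarrow> \<xi> = \<eta>"
  by (intro fiber_ext)

lemma norm_rep_le:
  assumes "\<And>s. norm (a s) \<le> B"
  shows "norm (rep a) \<le> B"
  unfolding rep_def regular_rep_def left_translation_def by (intro norm_block_diag_le assms)

lemma rep_bounded: "a \<in> carrier linf_compact \<Longrightarrow> rep a \<in> bounded_ops"
  unfolding rep_def regular_rep_def
  by (intro block_diag_bounded rep_aux bounded_translates linf_bounded_range)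
    (simp_all add: left_translation_def linf_bounded_ops)

lemma adjoint_rep:
  assumes a: "a \<in> carrier linf_compact"
  shows "adjoint_op (rep a) = rep (\<lambda>s. adjoint_op (a s))"
proof -
  have "adjoint_op (rep a) = block_diag (\<lambda>t. adjoint_op (block_diag (left_translation (- t) a)))"
    unfolding rep_def regular_rep_def
    by (intro adjoint_block_diag rep_aux block_diag_bounded bounded_translates linf_bounded_range a)
      (simp add: left_translation_def linf_bounded_ops a)
  also have "\<dots> = block_diag (\<lambda>t. block_diag (left_translation (- t) (\<lambda>s. adjoint_op (a s))))"
  proof -
    have "adjoint_op (block_diag (left_translation (- t) a)) =
        block_diag (\<lambda>s. adjoint_op (left_translation (- t) a s))" for t
      by (intro adjoint_block_diag bounded_translates linf_bounded_range a)
        (simp add: left_translation_def linf_bounded_ops a)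
    then show ?thesis
      by (simp add: left_translation_def)
  qed
  finally show ?thesis
    unfolding rep_def regular_rep_def .
qed

lemma rep_add:
  assumes "a \<in> carrier linf_compact" "b \<in> carrier linf_compact"
  shows "rep (\<lambda>s. a s + b s) = rep a + rep b"
  by (intro blinfun_eqI fiber_fiber_ext)
    (simp add: fiber_rep linf_bounded_range linf_add_closed assms blinfun.add_left fiber_add)

lemma rep_diff:
  assumes "bounded (range a)" "bounded (range b)" "bounded (range (\<lambda>s. a s - b s))"
  shows "rep (\<lambda>s. a s - b s) = rep a - rep b"
  by (intro blinfun_eqI fiber_fiber_ext)
    (simp add: fiber_rep assms blinfun.diff_left fiber_diff)

lemma rep_scale:
  assumes "a \<in> carrier linf_compact"
  shows "rep (\<lambda>s. op_scale c (a s)) = op_scale c (rep a)"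
  by (intro blinfun_eqI fiber_fiber_ext)
    (simp add: fiber_rep linf_bounded_range linf_scale_closed assms op_scale_apply fiber_scaleC)

lemma rep_mult:
  assumes "a \<in> carrier linf_compact" "b \<in> carrier linf_compact"
  shows "rep (\<lambda>s. a s o\<^sub>L b s) = rep a o\<^sub>L rep b"
  by (intro blinfun_eqI fiber_fiber_ext)
    (simp add: fiber_rep linf_bounded_range linf_mult_closed assms)

text \<open>At (t, r) both sides apply a (- s + t + r) to the double fiber of the vector at (- s +
  t, r).\<close>

lemma rep_covariant:
  assumes "a \<in> carrier linf_compact"
  shows "translation s o\<^sub>L rep a = rep (left_translation s a) o\<^sub>L translation s"
  by (intro blinfun_eqI fiber_fiber_ext)
    (simp add: fiber_rep fiber_translation linf_bounded_range linf_translation assms,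
     simp add: left_translation_def add.assoc)

section \<open>The dense *-subalgebra of finite sums\<close>

abbreviation roe_gens :: "('g::group_add \<times> 'g \<times> nat) op set" where
  "roe_gens \<equiv> algebraic_crossed_product linf_compact left_translation block_diag"

lemma roe_gens_eq:
  "roe_gens = {\<Sum>s\<in>F. rep (a s) o\<^sub>L translation s | F a. finite F \<and> (\<forall>s\<in>F. a s \<in> carrier linf_compact)}"
  unfolding algebraic_crossed_product_def rep_def ..

lemma roe_gens_zero: "0 \<in> roe_gens"
  unfolding roe_gens_eq by (intro CollectI exI[of _ "{}"]) auto

lemma roe_gens_gen: "a \<in> carrier linf_compact \<Longrightarrow> rep a o\<^sub>L translation s \<in> roe_gens"
  unfolding roe_gens_eq by (intro CollectI exI[of _ "{s}"] exI[of _ "\<lambda>_. a"]) auto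

lemma roe_gens_add:
  assumes "x \<in> roe_gens" "y \<in> roe_gens"
  shows "x + y \<in> roe_gens"
proof -
  obtain F a where x: "finite F" "\<And>s. s \<in> F \<Longrightarrow> a s \<in> carrier linf_compact"
    "x = (\<Sum>s\<in>F. rep (a s) o\<^sub>L translation s)"
    using assms(1) unfolding roe_gens_eq by blast
  obtain H b where y: "finite H" "\<And>s. s \<in> H \<Longrightarrow> b s \<in> carrier linf_compact"
    "y = (\<Sum>s\<in>H. rep (b s) o\<^sub>L translation s)"
    using assms(2) unfolding roe_gens_eq by blast
  have zero: "(\<lambda>_. 0) \<in> carrier linf_compact"
    unfolding linf_carrier_iff using compact_zero by auto
  \<comment> \<open>Extending the coefficients by zero puts both sums over the common index set F
    \<union> H.\<close>
  define a' b' where "a' s = (if s \<in> F then a s else (\<lambda>_. 0))" and "b' s = (if s \<in> H then b s else (\<lambda>_. 0))" for s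
  have carr: "a' s \<in> carrier linf_compact" "b' s \<in> carrier linf_compact" for s
    using x(2) y(2) zero by (auto simp: a'_def b'_def)
  have rep0: "rep (\<lambda>_. 0) = 0"
    using rep_add[OF zero zero] by simp
  have "x = (\<Sum>s\<in>F \<union> H. rep (a' s) o\<^sub>L translation s)"
    unfolding x(3) by (rule sum.mono_neutral_cong_left) (auto simp: a'_def rep0 x y)
  moreover have "y = (\<Sum>s\<in>F \<union> H. rep (b' s) o\<^sub>L translation s)"
    unfolding y(3) by (rule sum.mono_neutral_cong_left) (auto simp: b'_def rep0 x y)
  ultimately have "x + y = (\<Sum>s\<in>F \<union> H. rep (\<lambda>r. a' s r + b' s r) o\<^sub>L translation s)"
    by (simp add: rep_add carr compose_simps sum.distrib)
  moreover have "\<forall>s\<in>F \<union> H. (\<lambda>r. a' s r + b' s r) \<in> carrier linf_compact"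
    using carr linf_add_closed by blast
  ultimately show ?thesis
    unfolding roe_gens_eq using x(1) y(1)
    by (intro CollectI exI[of _ "F \<union> H"] exI[of _ "\<lambda>s r. a' s r + b' s r"]) simp
qed

lemma roe_gens_induct [consumes 1, case_names zero add gen]:
  assumes x: "x \<in> roe_gens"
    and zero: "P 0" and add: "\<And>x y. P x \<Longrightarrow> P y \<Longrightarrow> P (x + y)"
    and gen: "\<And>a s. a \<in> carrier linf_compact \<Longrightarrow> P (rep a o\<^sub>L translation s)"
  shows "P x"
proof -
  obtain F a where x: "finite F" "\<forall>s\<in>F. a s \<in> carrier linf_compact"
    "x = (\<Sum>s\<in>F. rep (a s) o\<^sub>L translation s)"
    using x unfolding roe_gens_eq by blast
  show ?thesis
    unfolding x(3) using x(1,2) by induction (auto intro: zero add gen)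
qed

lemma roe_gens_bounded: "x \<in> roe_gens \<Longrightarrow> x \<in> bounded_ops"
proof (induction rule: roe_gens_induct)
  case zero
  show ?case
    by (auto simp: bounded_ops_def intro!: ell2_eqI) (simp add: coord_simps)
qed (auto intro: bounded_ops_add bounded_ops_compose rep_bounded translation_bounded)

lemma roe_gens_scale: "x \<in> roe_gens \<Longrightarrow> op_scale c x \<in> roe_gens"
proof (induction rule: roe_gens_induct)
  case zero
  show ?case
    using roe_gens_zero by (simp add: linear_0[OF bounded_linear.linear[OF bounded_linear_op_scale]])
next
  case (gen a s)
  then show ?case
    using roe_gens_gen[OF linf_scale_closed[OF gen], of c s] by (simp add: rep_scale op_scale_compose)
qed (simp add: op_scale_add roe_gens_add)

text \<open>Induction in both factors reduces to two generators, where covariance moves the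
  translation past the second coefficient.\<close>

lemma roe_gens_mult:
  assumes x: "x \<in> roe_gens" and y: "y \<in> roe_gens"
  shows "x o\<^sub>L y \<in> roe_gens"
  using x
proof (induction rule: roe_gens_induct)
  case (gen a s)
  show ?case
    using y
  proof (induction rule: roe_gens_induct)
    case (gen b t)
    note sb = linf_translation[OF gen, of s]
    have "(rep a o\<^sub>L translation s) o\<^sub>L (rep b o\<^sub>L translation t) =
        rep a o\<^sub>L ((translation s o\<^sub>L rep b) o\<^sub>L translation t)"
      by (simp add: compose_assoc)
    also have "\<dots> = (rep a o\<^sub>L rep (left_translation s b)) o\<^sub>L (translation s o\<^sub>L translation t)"
      by (simp add: rep_covariant[OF gen] compose_assoc)
    also have "\<dots> = rep (\<lambda>r. a r o\<^sub>L left_translation s b r) o\<^sub>L translation (s + t)"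
      by (simp add: rep_mult \<open>a \<in> carrier linf_compact\<close> sb translation_compose)
    finally show ?case
      using roe_gens_gen[OF linf_mult_closed[OF \<open>a \<in> carrier linf_compact\<close> sb]] by simp
  qed (simp_all add: roe_gens_zero roe_gens_add compose_simps)
qed (simp_all add: roe_gens_zero roe_gens_add compose_simps)

text \<open>Boundedness is carried through the induction because \<open>adjoint_add\<close> requires
  it of both summands.\<close>

lemma roe_gens_adjoint: "x \<in> roe_gens \<Longrightarrow> adjoint_op x \<in> roe_gens \<and> x \<in> bounded_ops"
proof (induction rule: roe_gens_induct)
  case zero
  have "adjoint_op (0 :: ('a \<times> 'a \<times> nat) op) = 0"
    using adjoint_diff[OF roe_gens_bounded roe_gens_bounded, OF roe_gens_zero roe_gens_zero] by simp
  then show ?case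
    using roe_gens_zero roe_gens_bounded[OF roe_gens_zero] by simp
next
  case (add x y)
  then show ?case
    by (simp add: adjoint_add roe_gens_add bounded_ops_add)
next
  case (gen a s)
  note a' = linf_star_closed[OF gen]
  have "adjoint_op (rep a o\<^sub>L translation s) = translation (- s) o\<^sub>L rep (\<lambda>s. adjoint_op (a s))"
    by (simp add: adjoint_compose rep_bounded gen translation_bounded adjoint_translation adjoint_rep)
  also have "\<dots> = rep (left_translation (- s) (\<lambda>s. adjoint_op (a s))) o\<^sub>L translation (- s)"
    by (rule rep_covariant[OF a'])
  finally show ?case
    using roe_gens_gen[OF linf_translation[OF a']] roe_gens_bounded[OF roe_gens_gen[OF gen]] by simp
qed

section \<open>The norm closure and its approximate unit\<close>

lemma roe_simps:
  "carrier roe_algebra = closure roe_gens"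
  "add roe_algebra = (+)" "scale roe_algebra = op_scale" "mult roe_algebra = (o\<^sub>L)"
  "star roe_algebra = adjoint_op" "cnorm roe_algebra = norm"
  by (simp_all add: roe_algebra_def reduced_crossed_product_def op_algebra_def)

lemma roe_bounded: "x \<in> closure roe_gens \<Longrightarrow> x \<in> bounded_ops"
  using closure_minimal[OF _ closed_bounded_ops] roe_gens_bounded by blast

lemma roe_add:
  assumes "x \<in> closure roe_gens" "y \<in> closure roe_gens"
  shows "x + y \<in> closure roe_gens"
proof -
  obtain f g where "\<And>n. f n \<in> roe_gens" "f \<longlonglongrightarrow> x" "\<And>n. g n \<in> roe_gens" "g \<longlonglongrightarrow> y"
    using assms unfolding closure_sequential by blast
  then show ?thesis
    unfolding closure_sequential
    by (intro exI[of _ "\<lambda>n. f n + g n"]) (simp add: roe_gens_add tendsto_add)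
qed

lemma roe_mult:
  assumes "x \<in> closure roe_gens" "y \<in> closure roe_gens"
  shows "x o\<^sub>L y \<in> closure roe_gens"
proof -
  obtain f g where "\<And>n. f n \<in> roe_gens" "f \<longlonglongrightarrow> x" "\<And>n. g n \<in> roe_gens" "g \<longlonglongrightarrow> y"
    using assms unfolding closure_sequential by blast
  then show ?thesis
    unfolding closure_sequential
    by (intro exI[of _ "\<lambda>n. f n o\<^sub>L g n"])
      (simp add: roe_gens_mult bounded_bilinear.tendsto[OF bounded_bilinear_blinfun_compose])
qed

lemma roe_scale:
  assumes "x \<in> closure roe_gens"
  shows "op_scale c x \<in> closure roe_gens"
proof -
  obtain f where "\<And>n. f n \<in> roe_gens" "f \<longlonglongrightarrow> x"
    using assms unfolding closure_sequential by blast
  then show ?thesis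
    unfolding closure_sequential
    by (intro exI[of _ "\<lambda>n. op_scale c (f n)"])
      (simp add: roe_gens_scale bounded_linear.tendsto[OF bounded_linear_op_scale])
qed

lemma roe_adjoint:
  assumes x: "x \<in> closure roe_gens"
  shows "adjoint_op x \<in> closure roe_gens"
proof -
  obtain f where f: "\<And>n. f n \<in> roe_gens" "f \<longlonglongrightarrow> x"
    using x unfolding closure_sequential by blast
  have "(\<lambda>n. adjoint_op (f n)) \<longlonglongrightarrow> adjoint_op x"
  proof (rule LIM_zero_cancel, rule Lim_null_comparison)
    show "(\<lambda>n. norm (f n - x)) \<longlonglongrightarrow> 0"
      using f(2) by (simp add: LIM_zero tendsto_norm_zero)
    have "norm (adjoint_op (f n) - adjoint_op x) \<le> norm (f n - x)" for n
      using norm_adjoint_le[OF bounded_ops_diff] adjoint_diff[of "f n" x]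
        roe_gens_bounded[OF f(1)] roe_bounded[OF x] by metis
    then show "\<forall>\<^sub>F n in sequentially. norm (adjoint_op (f n) - adjoint_op x) \<le> norm (f n - x)"
      by simp
  qed
  then show ?thesis
    unfolding closure_sequential
    by (intro exI[of _ "\<lambda>n. adjoint_op (f n)"]) (simp add: f(1) roe_gens_adjoint)
qed

lemma rep_roe: "a \<in> carrier linf_compact \<Longrightarrow> rep a \<in> closure roe_gens"
proof -
  assume "a \<in> carrier linf_compact"
  moreover have "rep a o\<^sub>L translation 0 = rep a"
    by (rule blinfun_eqI) (simp add: translation_zero)
  ultimately show "rep a \<in> closure roe_gens"
    using roe_gens_gen[of a 0] closure_subset[of roe_gens] by auto
qed

text \<open>Left multiplication by a projection field acts only on the coefficient of a generator,
  where \<open>linf_approx\<close> applies. Quantifying over all n above m lets the bounds for two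
  summands be combined at the pointwise maximum.\<close>

lemma roe_gens_approx:
  assumes "x \<in> roe_gens" "0 < \<epsilon>"
  shows "\<exists>m. \<forall>n. (\<forall>s. m s \<le> n s) \<longrightarrow> norm (x - (rep (\<lambda>s. trunc (n s)) o\<^sub>L x)) \<le> \<epsilon>"
  using assms
proof (induction arbitrary: \<epsilon> rule: roe_gens_induct)
  case zero
  then show ?case
    by simp
next
  case (add x y)
  obtain m k where m: "\<And>n. (\<forall>s. m s \<le> n s) \<Longrightarrow> norm (x - (rep (\<lambda>s. trunc (n s)) o\<^sub>L x)) \<le> \<epsilon> / 2"
    and k: "\<And>n. (\<forall>s. k s \<le> n s) \<Longrightarrow> norm (y - (rep (\<lambda>s. trunc (n s)) o\<^sub>L y)) \<le> \<epsilon> / 2"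
    using add.IH[of "\<epsilon> / 2"] add.prems by (metis half_gt_zero)
  show ?case
  proof (intro exI[of _ "\<lambda>s. max (m s) (k s)"] allI impI)
    fix n assume n: "\<forall>s. max (m s) (k s) \<le> n s"
    let ?p = "rep (\<lambda>s. trunc (n s))"
    have "norm (x - (?p o\<^sub>L x)) \<le> \<epsilon> / 2" "norm (y - (?p o\<^sub>L y)) \<le> \<epsilon> / 2"
      using m[of n] k[of n] n by simp_all
    then have "norm ((x - (?p o\<^sub>L x)) + (y - (?p o\<^sub>L y))) \<le> \<epsilon> / 2 + \<epsilon> / 2"
      by (rule norm_triangle_mono)
    also have "(x - (?p o\<^sub>L x)) + (y - (?p o\<^sub>L y)) = (x + y) - (?p o\<^sub>L (x + y))"
      by (simp add: compose_simps)
    finally show "norm ((x + y) - (?p o\<^sub>L (x + y))) \<le> \<epsilon>"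
      by simp
  qed
next
  case (gen a t)
  obtain m where m: "\<And>s n. m s \<le> n \<Longrightarrow> norm (a s - (trunc n o\<^sub>L a s)) < \<epsilon>"
    using linf_approx[OF gen] by blast
  show ?case
  proof (intro exI[of _ m] allI impI)
    fix n assume n: "\<forall>s. m s \<le> n s"
    let ?p = "\<lambda>s. trunc (n s)"
    note pa = linf_mult_closed[OF linf_trunc[of n] gen(1)]
    have le: "norm (a s - (?p s o\<^sub>L a s)) \<le> \<epsilon>" for s
      using m n by (simp add: less_imp_le)
    then have "bounded (range (\<lambda>s. a s - (?p s o\<^sub>L a s)))"
      by (auto simp: bounded_iff)
    then have eq: "(rep a o\<^sub>L translation t) - (rep ?p o\<^sub>L (rep a o\<^sub>L translation t)) =
        rep (\<lambda>s. a s - (?p s o\<^sub>L a s)) o\<^sub>L translation t"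
      by (simp add: rep_diff linf_bounded_range gen pa rep_mult linf_trunc compose_simps compose_assoc)
    have "norm \<dots> \<le> norm (rep (\<lambda>s. a s - (?p s o\<^sub>L a s))) * norm (translation t :: ('a \<times> 'a \<times> nat) op)"
      by (rule norm_blinfun_compose)
    also have "\<dots> \<le> \<epsilon> * 1"
      using gen(2) by (intro mult_mono norm_translation_le norm_rep_le le) auto
    finally show "norm ((rep a o\<^sub>L translation t) - (rep ?p o\<^sub>L (rep a o\<^sub>L translation t))) \<le> \<epsilon>"
      unfolding eq by simp
  qed
qed

lemma roe_approx:
  assumes x: "x \<in> closure roe_gens" and \<epsilon>: "0 < \<epsilon>"
  shows "\<exists>m. norm (x - (rep (\<lambda>s. trunc (m s)) o\<^sub>L x)) < \<epsilon>"
proof -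
  obtain y where y: "y \<in> roe_gens" "norm (y - x) < \<epsilon> / 4"
    using x[unfolded closure_approachable, rule_format, of "\<epsilon> / 4"] \<epsilon> by (auto simp: dist_norm)
  then obtain m where m: "norm (y - (rep (\<lambda>s. trunc (m s)) o\<^sub>L y)) \<le> \<epsilon> / 4"
    using roe_gens_approx[OF y(1), of "\<epsilon> / 4"] \<epsilon> by auto
  let ?p = "rep (\<lambda>s. trunc (m s))"
  have "norm (?p o\<^sub>L (y - x)) \<le> norm ?p * norm (y - x)"
    by (rule norm_blinfun_compose)
  also have "\<dots> \<le> 1 * (\<epsilon> / 4)"
    using y(2) by (intro mult_mono norm_rep_le norm_pull_op_le) auto
  finally have "norm (?p o\<^sub>L (y - x)) \<le> \<epsilon> / 4"
    by simp
  moreover have "norm ((y - (?p o\<^sub>L y)) + (?p o\<^sub>L (y - x))) \<le> norm (y - (?p o\<^sub>L y)) + norm (?p o\<^sub>L (y - x))"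
    by (rule norm_triangle_ineq)
  moreover have "x - (?p o\<^sub>L x) = (x - y) + ((y - (?p o\<^sub>L y)) + (?p o\<^sub>L (y - x)))"
    by (simp add: compose_simps)
  then have "norm (x - (?p o\<^sub>L x)) \<le> norm (x - y) + norm ((y - (?p o\<^sub>L y)) + (?p o\<^sub>L (y - x)))"
    by (simp only: norm_triangle_ineq)
  ultimately have "norm (x - (?p o\<^sub>L x)) < \<epsilon>"
    using m y(2) \<epsilon> norm_minus_commute[of x y] by linarith
  then show ?thesis
    by blast
qed

lemma rank_algebra_roe:
  "rank_algebra (roe_algebra :: ('g::group_add \<times> 'g \<times> nat) op cstar) (\<lambda>m. rep (\<lambda>s. trunc (m s)))"
proof (unfold_locales, unfold roe_simps)
  fix x y z :: "('g \<times> 'g \<times> nat) op" and c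
  assume x: "x \<in> closure roe_gens"
  note xb = roe_bounded[OF x]
  show "op_scale c x \<in> closure roe_gens" "adjoint_op x \<in> closure roe_gens"
    using x by (rule roe_scale roe_adjoint)+
  show "adjoint_op (op_scale c x) = op_scale (cnj c) (adjoint_op x)" "adjoint_op (adjoint_op x) = x"
    using xb by (rule adjoint_scale adjoint_adjoint)+
  show "\<exists>m. norm (x + op_scale (- 1) (rep (\<lambda>s. trunc (m s)) o\<^sub>L x)) < \<epsilon>" if "0 < \<epsilon>" for \<epsilon>
    using roe_approx[OF x that] by (simp add: op_scale_minus_one)
  assume y: "y \<in> closure roe_gens"
  note yb = roe_bounded[OF y]
  show "x + y \<in> closure roe_gens" "x o\<^sub>L y \<in> closure roe_gens"
    using x y by (rule roe_add roe_mult)+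
  show "op_scale c x o\<^sub>L y = op_scale c (x o\<^sub>L y)" "x o\<^sub>L op_scale c y = op_scale c (x o\<^sub>L y)"
    "op_scale c (x + y) = op_scale c x + op_scale c y"
    "adjoint_op (x + y) = adjoint_op x + adjoint_op y"
    "adjoint_op (x o\<^sub>L y) = adjoint_op y o\<^sub>L adjoint_op x"
    by (simp_all add: op_scale_compose compose_op_scale op_scale_add adjoint_add adjoint_compose xb yb)
  show "\<exists>v\<in>closure roe_gens. x = (y o\<^sub>L x) + (v o\<^sub>L (y o\<^sub>L x))"
    if e: "x o\<^sub>L x = x" and less: "norm (x + op_scale (- 1) y) < 1"
  proof -
    have d: "x - y \<in> closure roe_gens" "norm (x - y) < 1"
      using roe_add[OF x roe_scale[OF y, of "-1"]] less by (simp_all add: op_scale_minus_one)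
    have "0 \<in> closure roe_gens"
      using roe_gens_zero closure_subset by blast
    then obtain v where "v \<in> closure roe_gens" "v = (x - y) + (v o\<^sub>L (x - y))"
      by (rule quasi_inverse[OF closed_closure _ roe_add roe_mult d(1) order_refl d(2)])
    then show ?thesis
      using idempotent_factorization[OF e] by blast
  qed
  assume z: "z \<in> closure roe_gens"
  show "(x o\<^sub>L y) o\<^sub>L z = x o\<^sub>L (y o\<^sub>L z)" "(x + y) o\<^sub>L z = (x o\<^sub>L z) + (y o\<^sub>L z)"
    "x o\<^sub>L (y + z) = (x o\<^sub>L y) + (x o\<^sub>L z)"
    by (simp_all add: compose_assoc compose_simps)
next
  fix m n :: "'g \<Rightarrow> nat"
  show "rep (\<lambda>s. trunc (m s)) \<in> closure roe_gens"
    by (rule rep_roe[OF linf_trunc])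
  show "rep (\<lambda>s. trunc (m s)) o\<^sub>L rep (\<lambda>s. trunc (m s)) = rep (\<lambda>s. trunc (m s))"
    "adjoint_op (rep (\<lambda>s. trunc (m s))) = rep (\<lambda>s. trunc (m s))"
    by (simp_all add: rep_mult[symmetric] linf_trunc trunc_trunc adjoint_rep adjoint_trunc)
  \<comment> \<open>The partial isometry for \<open>p_add\<close> is the same field of shifts as
    before, transported by \<open>rep\<close>.\<close>
  define v where "v = (\<lambda>s. shift_op (m s) (n s))"
  have v: "v \<in> carrier linf_compact"
    unfolding v_def by (rule linf_shift)
  note v' = linf_star_closed[OF v]
  have "adjoint_op (rep v) o\<^sub>L rep v = rep (\<lambda>s. trunc (n s))"
    "rep v o\<^sub>L rep (\<lambda>s. trunc (n s)) = rep v"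
    "rep (\<lambda>s. trunc (m s)) + (rep v o\<^sub>L adjoint_op (rep v)) = rep (\<lambda>s. trunc (m s + n s))"
    unfolding adjoint_rep[OF v] rep_mult[OF v v', symmetric] rep_mult[OF v' v, symmetric]
      rep_mult[OF v linf_trunc, symmetric] rep_add[OF linf_trunc linf_mult_closed[OF v v'], symmetric]
    by (simp_all add: v_def shift_op_initial shift_op_trunc trunc_add)
  then show "\<exists>v\<in>closure roe_gens. adjoint_op v o\<^sub>L v = rep (\<lambda>s. trunc (n s)) \<and>
      v o\<^sub>L rep (\<lambda>s. trunc (n s)) = v \<and>
      rep (\<lambda>s. trunc (m s + n s)) = rep (\<lambda>s. trunc (m s)) + (v o\<^sub>L adjoint_op v)"
    by (intro bexI[OF _ rep_roe[OF v]]) simp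
qed

text \<open>No invariance has to be assumed: the translations lie next to the coefficients in the
  crossed product and make the rank-one projections at any two points of the group
  equivalent.\<close>

lemma no_trace_roe:
  assumes "countable (UNIV :: 'g::group_add set)" "infinite (UNIV :: 'g set)"
    and tr: "densely_defined_lsc_trace (roe_algebra :: ('g \<times> 'g \<times> nat) op cstar) \<tau>"
  shows "\<not> nonzero_trace roe_algebra \<tau>"
proof -
  interpret rank_algebra "roe_algebra :: ('g \<times> 'g \<times> nat) op cstar" "\<lambda>m. rep (\<lambda>s. trunc (m s))"
    by (rule rank_algebra_roe)
  show ?thesis
  proof (rule no_trace[OF assms])
    fix s t :: 'g
    define r where "r = t - s"
    define p where "p = (\<lambda>q. trunc (indicator {s} q))"
    have p: "p \<in> carrier linf_compact"
      unfolding p_def by (rule linf_trunc)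
    note rp = linf_translation[OF p, of r]
    have pp: "rep p o\<^sub>L rep p = rep p" "adjoint_op (rep p) = rep p"
      unfolding adjoint_rep[OF p] rep_mult[OF p p, symmetric]
      by (simp_all add: p_def trunc_trunc adjoint_trunc)
    \<comment> \<open>The sign is chosen so that x* x is the conjugate of \<open>rep p\<close> by
      the translation r, carrying s to t, while x x* is \<open>rep p\<close> itself.\<close>
    define x where "x = rep p o\<^sub>L translation (- r)"
    have x: "x \<in> closure roe_gens"
      unfolding x_def using roe_gens_gen[OF p] closure_subset by blast
    have x': "adjoint_op x = translation r o\<^sub>L rep p"
      unfolding x_def
      by (simp add: adjoint_compose rep_bounded p translation_bounded adjoint_translation pp)
    have "adjoint_op x o\<^sub>L x = (translation r o\<^sub>L (rep p o\<^sub>L rep p)) o\<^sub>L translation (- r)"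
      unfolding x' unfolding x_def by (simp only: compose_assoc)
    also have "\<dots> = rep (left_translation r p) o\<^sub>L (translation r o\<^sub>L translation (- r))"
      by (simp only: pp rep_covariant[OF p] compose_assoc)
    also have "\<dots> = rep (\<lambda>q. trunc (indicator {t} q)) o\<^sub>L id_blinfun"
      unfolding translation_compose right_minus translation_zero
      unfolding p_def r_def translation_indicator[of t s trunc] ..
    also have "\<dots> = rep (\<lambda>q. trunc (indicator {t} q))"
      by (rule blinfun_eqI) simp
    finally have 1: "adjoint_op x o\<^sub>L x = rep (\<lambda>q. trunc (indicator {t} q))" .
    have "x o\<^sub>L adjoint_op x = rep p o\<^sub>L ((translation (- r) o\<^sub>L translation r) o\<^sub>L rep p)"
      unfolding x' unfolding x_def by (simp only: compose_assoc)
    also have "\<dots> = rep p o\<^sub>L rep p"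
      by (rule blinfun_eqI) (simp add: translation_compose translation_zero)
    also have "\<dots> = rep p"
      by (rule pp)
    finally have 2: "x o\<^sub>L adjoint_op x = rep p" .
    have "\<tau> (adjoint_op x o\<^sub>L x) = \<tau> (x o\<^sub>L adjoint_op x)"
      using trace_comm[OF tr, of x] x 1 p_pideal by (simp add: roe_simps)
    then show "\<tau> (rep (\<lambda>q. trunc (indicator {s} q))) = \<tau> (rep (\<lambda>q. trunc (indicator {t} q)))"
      unfolding 1 2 by (simp add: p_def)
  qed
qed

theorem corollary5p3:
  assumes "countable (UNIV :: 'g::group_add set)" and "infinite (UNIV :: 'g set)"
  shows "(\<nexists>\<tau> :: ('g \<Rightarrow> nat op) \<Rightarrow> complex.
            densely_defined_lsc_trace linf_compact \<tau> \<and>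
            invariant_trace linf_compact (left_translation :: 'g \<Rightarrow> _) \<tau> \<and>
            nonzero_trace linf_compact \<tau>) \<and>
         (\<nexists>\<tau> :: ('g \<times> 'g \<times> nat) op \<Rightarrow> complex.
            densely_defined_lsc_trace roe_algebra \<tau> \<and>
            nonzero_trace roe_algebra \<tau>)"
  using no_invariant_trace_linf[OF assms] no_trace_roe[OF assms] by blast

end
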